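(* Let $\Gamma$ be a Lie group acting smoothly, freely, and properly (on the left) on a smooth manifold $\tilde{X}$, let $X = \tilde{X}/\Gamma$ be the quotient manifold, and let $q : \tilde{X} \to X$ be the canonical quotient map. Let $\tilde{f} : \tilde{X}\times\mathbb{R} \to T\tilde{X}$ be a smooth time-dependent vector field on $\tilde{X}$ such that, for any smooth function $\tilde{s} : \tilde{X} \to \mathbb{R}$ satisfying $$\tilde{s}(\tilde{x}) = \tilde{s}(\gamma \cdot \tilde{x}) \quad \text{for all } \tilde{x} \in \tilde{X} \text{ and } \gamma \in \Gamma,$$ we have $$\mathcal{L}_{\tilde{f}}\tilde{s}(\tilde{x},t) = \mathcal{L}_{\tilde{f}}\tilde{s}(\gamma \cdot \tilde{x},t) \quad \text{for all } (\tilde{x},t) \in \tilde{X}\times\mathbb{R} \text{ and } \gamma \in \Gamma.$$ Then there exists a unique smooth time-dependent vector field $f : X\times\mathbb{R} \to TX$ on $X$ that is $q$-related to $\tilde{f}$.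
   Context: For a left action $(\gamma,\tilde{x}) \mapsto \gamma\cdot\tilde{x}$ of $\Gamma$ on $\tilde{X}$, the orbit of $\tilde{x}$ is $\Gamma\cdot\tilde{x} = \{\gamma\cdot\tilde{x} \mid \gamma\in\Gamma\}$, the quotient $\tilde{X}/\Gamma$ is the set of orbits, and the canonical quotient map $q$ sends $\tilde{x}$ to its orbit. The action is free if $\gamma\cdot\tilde{x} = \tilde{x}$ for some $\tilde{x}\in\tilde{X}$ implies $\gamma = e$ (the identity of $\Gamma$). It is proper if the map $\Gamma\times\tilde{X}\to\tilde{X}\times\tilde{X}$, $(\gamma,\tilde{x})\mapsto(\gamma\cdot\tilde{x},\tilde{x})$, is a proper map (preimages of compact sets are compact). By the Quotient Manifold Theorem, for a smooth, free, and proper action of a Lie group, $X = \tilde{X}/\Gamma$ is a topological manifold of dimension $\dim\tilde{X}-\dim\Gamma$ with a unique smooth structure such that $q:\tilde{X}\to X$ is a smooth submersion; $X$ is equipped with this smooth structure. A time-dependent vector field on a manifold $M$ is a map $g : M\times\mathbb{R}\to TM$ with $g(x,t)\in T_xM$ for all $(x,t)$; it is smooth if it is smooth as a map on $M \times \mathbb{R}$. For a smooth function $\tilde{s}:\tilde{X}\to\mathbb{R}$, $\mathcal{L}_{\tilde{f}}\tilde{s}(\tilde{x},t) = \tilde{f}(\tilde{x},t)\,\tilde{s}$ denotes the Lie derivative of $\tilde{s}$ along $\tilde{f}$, i.e. the tangent vector $\tilde{f}(\tilde{x},t)\in T_{\tilde{x}}\tilde{X}$ applied as a derivation to $\tilde{s}$.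 The pushforward $q_* : T_{\tilde{x}}\tilde{X}\to T_{q(\tilde{x})}X$ is defined by $(q_*v)g = v(g\circ q)$ for $v\in T_{\tilde{x}}\tilde{X}$ and smooth $g:X\to\mathbb{R}$. The time-dependent vector fields $\tilde{f}$ on $\tilde{X}$ and $f$ on $X$ are $q$-related if $q_*\tilde{f}(\tilde{x},t) = f(q(\tilde{x}),t)$ for all $(\tilde{x},t)\in\tilde{X}\times\mathbb{R}$. *)

theory Defs
  imports "HOL-Analysis.Analysis" "HOL-Algebra.Group_Action"
begin

section \<open>The 0-dimensional model space\<close>

text \<open>Manifolds below are modelled on an arbitrary finite-dimensional normed space rather than on an
  instance of \<^class>\<open>euclidean_space\<close>: the latter has dimension at least 1, whereas 0-dimensional
  manifolds, and in particular discrete groups, have to be covered. The only purpose of this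
  instance is to make a 0-dimensional model space available.\<close>

instantiation unit :: real_normed_vector
begin

definition "0 = ()"
definition "x + y = ()" for x y :: unit
definition "r *\<^sub>R x = ()" for r :: real and x :: unit
definition "norm x = 0" for x :: unit
definition "sgn x = ()" for x :: unit
definition "dist x y = 0" for x y :: unit
definition "uniformity = (INF e\<in>{0<..}. principal {(x :: unit, y). dist x y < e})"
definition "open U \<longleftrightarrow>
  (\<forall>x\<in>U. \<forall>\<^sub>F (x', y) in uniformity. x' = x \<longrightarrow> y \<in> U)" for U :: "unit set"

instance
  by standard (auto simp: norm_unit_def dist_unit_def uniformity_unit_def open_unit_def)

end


section \<open>Smooth maps between finite-dimensional normed spaces\<close>

text \<open>For open \<open>S\<close> in a finite-dimensional space, \<open>Ck_on k f S\<close> is the usual \<open>C\<^sup>k\<close>: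
  all iterated directional derivatives up to order \<open>k\<close> exist and are continuous.\<close>

primrec Ck_on ::
  "nat \<Rightarrow> ('a::real_normed_vector \<Rightarrow> 'b::real_normed_vector) \<Rightarrow> 'a set \<Rightarrow> bool" where
  "Ck_on 0 f S \<longleftrightarrow> continuous_on S f"
| "Ck_on (Suc k) f S \<longleftrightarrow>
     (\<forall>x\<in>S. f differentiable (at x)) \<and>
     (\<forall>v. Ck_on k (\<lambda>x. frechet_derivative f (at x) v) S)"

definition smooth_on ::
  "('a::real_normed_vector \<Rightarrow> 'b::real_normed_vector) \<Rightarrow> 'a set \<Rightarrow> bool" where
  "smooth_on f S \<longleftrightarrow> (\<forall>k. Ck_on k f S)"


section \<open>Manifolds\<close>

text \<open>A manifold is given by its topology, whose \<open>topspace\<close> is the underlying set, and an atlas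
  (not necessarily maximal) generating the smooth structure. A chart is a pair of its domain and a
  coordinate map, whose values outside the domain are irrelevant. The dimension of the
  manifold is that of the model space.\<close>

type_synonym ('p, 'e) chart = "'p set \<times> ('p \<Rightarrow> 'e)"

record ('p, 'e) mfd =
  mtop :: "'p topology"
  atlas :: "('p, 'e) chart set"

abbreviation pts :: "('p, 'e) mfd \<Rightarrow> 'p set" where
  "pts M \<equiv> topspace (mtop M)"

definition is_chart :: "'p topology \<Rightarrow> ('p, 'e::real_normed_vector) chart \<Rightarrow> bool" where
  "is_chart T = (\<lambda>(U, \<phi>). openin T U \<and> open (\<phi> ` U) \<and>
     homeomorphic_map (subtopology T U) (top_of_set (\<phi> ` U)) \<phi>)"

definition smoothly_compatible ::
  "('p, 'e::real_normed_vector) chart \<Rightarrow> ('p, 'e) chart \<Rightarrow> bool" where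
  "smoothly_compatible = (\<lambda>(U, \<phi>) (V, \<psi>). smooth_on (\<psi> \<circ> inv_into U \<phi>) (\<phi> ` (U \<inter> V)))"

definition smooth_manifold :: "('p, 'e::real_normed_vector) mfd \<Rightarrow> bool" where
  "smooth_manifold M \<longleftrightarrow>
     (\<exists>B :: 'e set. finite B \<and> span B = UNIV) \<and>
     Hausdorff_space (mtop M) \<and> second_countable (mtop M) \<and>
     (\<forall>c\<in>atlas M. is_chart (mtop M) c) \<and>
     pts M = (\<Union>c\<in>atlas M. fst c) \<and>
     (\<forall>c\<in>atlas M. \<forall>d\<in>atlas M. smoothly_compatible c d)"

definition smooth_map ::
  "('p, 'e::real_normed_vector) mfd \<Rightarrow> ('q, 'f::real_normed_vector) mfd \<Rightarrow> ('p \<Rightarrow> 'q) \<Rightarrow> bool" where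
  "smooth_map M N F \<longleftrightarrow>
     continuous_map (mtop M) (mtop N) F \<and>
     (\<forall>(U, \<phi>)\<in>atlas M. \<forall>(V, \<psi>)\<in>atlas N.
        smooth_on (\<psi> \<circ> F \<circ> inv_into U \<phi>) (\<phi> ` (U \<inter> F -` V)))"

definition vector_space_mfd :: "('e::real_normed_vector, 'e) mfd" where
  "vector_space_mfd = \<lparr>mtop = euclidean, atlas = {(UNIV, id)}\<rparr>"

abbreviation real_line :: "(real, real) mfd" where
  "real_line \<equiv> vector_space_mfd"

definition prod_mfd ::
  "('p, 'e) mfd \<Rightarrow> ('q, 'f) mfd \<Rightarrow> ('p \<times> 'q, 'e \<times> 'f) mfd" where
  "prod_mfd M N = \<lparr>mtop = prod_topology (mtop M) (mtop N),
     atlas = {(U \<times> V, map_prod \<phi> \<psi>) | U \<phi> V \<psi>. (U, \<phi>) \<in> atlas M \<and> (V, \<psi>) \<in> atlas N}\<rparr>"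

definition smooth_functions :: "('p, 'e::real_normed_vector) mfd \<Rightarrow> ('p \<Rightarrow> real) set" where
  "smooth_functions M = {g. smooth_map M real_line g}"


section \<open>Tangent vectors\<close>

text \<open>Tangent vectors are derivations of the algebra of smooth functions. Members of
  \<^term>\<open>smooth_functions M\<close> have arbitrary values outside the manifold, but a derivation does not
  see these: if \<open>h\<close> vanishes on the manifold then \<open>h = h \<cdot> \<chi>\<close> with \<open>\<chi>\<close> the indicator of the
  complement, so the product rule gives \<open>v h = 0\<close>. Outside \<^term>\<open>smooth_functions M\<close> the
  value is fixed to be 0, so that equal derivations are equal as HOL functions.\<close>

definition tangent_space ::
  "('p, 'e::real_normed_vector) mfd \<Rightarrow> 'p \<Rightarrow> (('p \<Rightarrow> real) \<Rightarrow> real) set" where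
  "tangent_space M p = {v.
     (\<forall>g\<in>smooth_functions M. \<forall>h\<in>smooth_functions M.
        v (\<lambda>x. g x + h x) = v g + v h \<and>
        v (\<lambda>x. g x * h x) = g p * v h + h p * v g) \<and>
     (\<forall>c. \<forall>g\<in>smooth_functions M. v (\<lambda>x. c * g x) = c * v g) \<and>
     (\<forall>g. g \<notin> smooth_functions M \<longrightarrow> v g = 0)}"

definition pushforward ::
  "('q, 'f::real_normed_vector) mfd \<Rightarrow> ('p \<Rightarrow> 'q) \<Rightarrow> (('p \<Rightarrow> real) \<Rightarrow> real) \<Rightarrow> (('q \<Rightarrow> real) \<Rightarrow> real)"
  where "pushforward N F v = (\<lambda>g. if g \<in> smooth_functions N then v (g \<circ> F) else 0)"

definition smooth_submersion ::
  "('p, 'e::real_normed_vector) mfd \<Rightarrow> ('q, 'f::real_normed_vector) mfd \<Rightarrow> ('p \<Rightarrow> 'q) \<Rightarrow> bool" where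
  "smooth_submersion M N F \<longleftrightarrow> smooth_map M N F \<and>
     (\<forall>p\<in>pts M. pushforward N F ` tangent_space M p = tangent_space N (F p))"


section \<open>The tangent bundle\<close>

text \<open>\<open>coord_vector M (U, \<phi>) p w\<close> is \<open>\<Sum>\<^sub>i w\<^sup>i \<partial>/\<partial>x\<^sup>i\<close> at \<open>p\<close>, with \<open>x\<^sup>i\<close> the coordinates given by \<open>\<phi>\<close>.\<close>

definition coord_vector ::
  "('p, 'e::real_normed_vector) mfd \<Rightarrow> ('p, 'e) chart \<Rightarrow> 'p \<Rightarrow> 'e \<Rightarrow> (('p \<Rightarrow> real) \<Rightarrow> real)" where
  "coord_vector M = (\<lambda>(U, \<phi>) p w g.
     if g \<in> smooth_functions M
     then frechet_derivative (g \<circ> inv_into U \<phi>) (at (\<phi> p)) w else 0)"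

text \<open>The chart of the tangent bundle induced by \<open>(U, \<phi>)\<close> maps \<open>\<Sum>\<^sub>i w\<^sup>i \<partial>/\<partial>x\<^sup>i\<close> at \<open>p\<close> to
  \<open>(\<phi> p, w)\<close>.\<close>

definition bundle_chart ::
  "('p, 'e::real_normed_vector) mfd \<Rightarrow> ('p, 'e) chart \<Rightarrow>
     ('p \<times> (('p \<Rightarrow> real) \<Rightarrow> real), 'e \<times> 'e) chart" where
  "bundle_chart M c =
     (Sigma (fst c) (tangent_space M),
      \<lambda>(p, v). (snd c p, THE w. v = coord_vector M c p w))"

definition tangent_bundle ::
  "('p, 'e::real_normed_vector) mfd \<Rightarrow> ('p \<times> (('p \<Rightarrow> real) \<Rightarrow> real), 'e \<times> 'e) mfd" where
  "tangent_bundle M =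
     \<lparr>mtop = topology_generated_by
        {{z \<in> W. \<Phi> z \<in> S} | W \<Phi> S. (W, \<Phi>) \<in> bundle_chart M ` atlas M \<and> open S},
      atlas = bundle_chart M ` atlas M\<rparr>"


section \<open>Time-dependent vector fields\<close>

text \<open>The field is stored as its fibre part: \<open>f (x, t)\<close> is the derivation, and
  \<open>(x, f (x, t))\<close> the corresponding element of the tangent bundle.\<close>

type_synonym 'p td_field = "'p \<times> real \<Rightarrow> ('p \<Rightarrow> real) \<Rightarrow> real"

definition smooth_td_vector_field ::
  "('p, 'e::real_normed_vector) mfd \<Rightarrow> 'p td_field \<Rightarrow> bool" where
  "smooth_td_vector_field M f \<longleftrightarrow>
     f \<in> (\<Pi>\<^sub>E (x, t) \<in> pts M \<times> UNIV. tangent_space M x) \<and>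
     smooth_map (prod_mfd M real_line) (tangent_bundle M) (\<lambda>(x, t). (x, f (x, t)))"

definition lie_derivative :: "'p td_field \<Rightarrow> ('p \<Rightarrow> real) \<Rightarrow> 'p \<times> real \<Rightarrow> real" where
  "lie_derivative f s = (\<lambda>(x, t). f (x, t) s)"

definition related_fields ::
  "('p, 'e::real_normed_vector) mfd \<Rightarrow> ('q, 'f::real_normed_vector) mfd \<Rightarrow> ('p \<Rightarrow> 'q) \<Rightarrow>
     'p td_field \<Rightarrow> 'q td_field \<Rightarrow> bool" where
  "related_fields M N F f g \<longleftrightarrow> (\<forall>x\<in>pts M. \<forall>t. pushforward N F (f (x, t)) = g (F x, t))"


section \<open>Lie group actions and quotients\<close>

definition lie_group ::
  "('g, 'z) monoid_scheme \<Rightarrow> ('g, 'e::real_normed_vector) mfd \<Rightarrow> bool" where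
  "lie_group G L \<longleftrightarrow> group G \<and> smooth_manifold L \<and> pts L = carrier G \<and>
     smooth_map (prod_mfd L L) L (\<lambda>(a, b). a \<otimes>\<^bsub>G\<^esub> b) \<and>
     smooth_map L L (\<lambda>a. inv\<^bsub>G\<^esub> a)"

definition smooth_action ::
  "('g, 'z) monoid_scheme \<Rightarrow> ('g, 'k::real_normed_vector) mfd \<Rightarrow>
     ('p, 'e::real_normed_vector) mfd \<Rightarrow> ('g \<Rightarrow> 'p \<Rightarrow> 'p) \<Rightarrow> bool" where
  "smooth_action G L M act \<longleftrightarrow> group_action G (pts M) act \<and>
     smooth_map (prod_mfd L M) M (\<lambda>(\<gamma>, x). act \<gamma> x)"

definition free_action ::
  "('g, 'z) monoid_scheme \<Rightarrow> 'p set \<Rightarrow> ('g \<Rightarrow> 'p \<Rightarrow> 'p) \<Rightarrow> bool" where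
  "free_action G E act \<longleftrightarrow> (\<forall>\<gamma>\<in>carrier G. \<forall>x\<in>E. act \<gamma> x = x \<longrightarrow> \<gamma> = \<one>\<^bsub>G\<^esub>)"

text \<open>The library's \<^const>\<open>proper_map\<close> means closed with compact fibres; here preimages of
  compact sets are required to be compact.\<close>

definition proper_action :: "'g topology \<Rightarrow> 'p topology \<Rightarrow> ('g \<Rightarrow> 'p \<Rightarrow> 'p) \<Rightarrow> bool" where
  "proper_action S T act \<longleftrightarrow>
     (\<forall>K. compactin (prod_topology T T) K \<longrightarrow>
        compactin (prod_topology S T)
          {(\<gamma>, x). \<gamma> \<in> topspace S \<and> x \<in> topspace T \<and> (act \<gamma> x, x) \<in> K})"

text \<open>The orbit space with the quotient topology and a smooth structure making the canonical map
  a smooth submersion. By the Quotient Manifold Theorem such a structure exists for a smooth, free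
  and proper action and is unique, so this determines \<open>X\<close> up to the choice of an atlas.\<close>

definition quotient_manifold ::
  "('g, 'z) monoid_scheme \<Rightarrow> ('p, 'e::real_normed_vector) mfd \<Rightarrow> ('g \<Rightarrow> 'p \<Rightarrow> 'p) \<Rightarrow>
     ('p set, 'f::real_normed_vector) mfd \<Rightarrow> bool" where
  "quotient_manifold G M act X \<longleftrightarrow> smooth_manifold X \<and>
     pts X = orbits G (pts M) act \<and>
     quotient_map (mtop M) (mtop X) (orbit G act) \<and>
     smooth_submersion M X (orbit G act)"

end

theory Submission
  imports Defs
begin

text \<open>Since \<open>q\<close> is a submersion, \<open>q\<^sub>*\<close> maps the tangent space at \<open>p\<close> onto the one at \<open>q p\<close>, and
  \<open>f (q p, t) = q\<^sub>* (ft (p, t))\<close> is the only candidate. It is well defined because \<open>g \<circ> q\<close> is an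
  invariant smooth function for every smooth \<open>g\<close> on \<open>X\<close>, so by hypothesis \<open>ft (p, t) (g \<circ> q)\<close> depends
  only on the orbit of \<open>p\<close>. In charts, the component vector of \<open>f\<close> at \<open>(y, t)\<close> is
  \<open>Dq (s y) (u (s y, t))\<close>, where \<open>u\<close> is that of \<open>ft\<close> and \<open>s\<close> is a smooth local section of \<open>q\<close>, which
  the inverse function theorem provides; hence \<open>f\<close> is smooth. Model spaces are arbitrary
  finite-dimensional normed spaces, to which the library's inverse function theorem for Euclidean
  spaces does not apply.\<close>


section \<open>Finite-dimensional normed spaces\<close>

text \<open>A field is here a family of derivations on global smooth functions, while its smoothness
  is a statement about component vectors. The link is that \<open>coord_vector\<close> maps the
  model space bijectively onto each tangent space; surjectivity is the substantial half and rests on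
  bump functions, the Hausdorff property and Hadamard's lemma. The same bijection turns the
  surjectivity of \<open>q\<^sub>*\<close> on derivations into surjectivity of the Jacobian of
  \<open>q\<close> in charts, which a local section requires. The section is what gives smoothness:
  the candidate field is defined by choosing a point in each fibre, and such a choice need not even
  be continuous. Since \<open>Ck_on\<close> speaks of derivatives in fixed directions only, steps in
  which point and direction vary together, such as inverting a Jacobian or pushing a vector forward,
  expand the direction in a basis.\<close>

lemma compact_coefficient_cube:
  fixes B :: "'a::real_normed_vector set"
  assumes "finite B"
  shows "compact {\<Sum>b\<in>B. a b *\<^sub>R b | a. \<forall>b\<in>B. \<bar>a b\<bar> \<le> r}"
  using assms
proof (induction B rule: finite_induct)
  case empty
  then show ?case by simp
next
  case (insert b B)
  let ?Q = "\<lambda>B. {\<Sum>b\<in>B. a b *\<^sub>R b | a. \<forall>b\<in>B. \<bar>a b\<bar> \<le> r}"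
  \<comment> \<open>Splitting off the coefficient of \<open>b\<close> makes the cube the Minkowski
    sum of a segment and a smaller cube.\<close>
  have "?Q (insert b B) = {x + y | x y. x \<in> (\<lambda>s. s *\<^sub>R b) ` {-r..r} \<and> y \<in> ?Q B}" (is "_ = ?R")
  proof (intro equalityI subsetI)
    fix z assume "z \<in> ?Q (insert b B)"
    then obtain a where "\<forall>c\<in>insert b B. \<bar>a c\<bar> \<le> r" "z = (\<Sum>c\<in>insert b B. a c *\<^sub>R c)" by blast
    then have "z = a b *\<^sub>R b + (\<Sum>c\<in>B. a c *\<^sub>R c)" "a b \<in> {-r..r}" "\<forall>c\<in>B. \<bar>a c\<bar> \<le> r"
      using insert by auto
    then show "z \<in> ?R" by blast
  next
    fix z assume "z \<in> ?R"
    then obtain s a where s: "s \<in> {-r..r}" and a: "\<forall>c\<in>B. \<bar>a c\<bar> \<le> r"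
      and z: "z = s *\<^sub>R b + (\<Sum>c\<in>B. a c *\<^sub>R c)" by blast
    have "(\<Sum>c\<in>B. (a(b := s)) c *\<^sub>R c) = (\<Sum>c\<in>B. a c *\<^sub>R c)"
      using insert by (intro sum.cong) auto
    then have "z = (\<Sum>c\<in>insert b B. (a(b := s)) c *\<^sub>R c)" using insert z by simp
    moreover have "\<forall>c\<in>insert b B. \<bar>(a(b := s)) c\<bar> \<le> r" using s a by auto
    ultimately show "z \<in> ?Q (insert b B)" by blast
  qed
  moreover have "compact ((\<lambda>s. s *\<^sub>R b) ` {-r..r})"
    by (intro compact_continuous_image continuous_intros) auto
  ultimately show ?case using compact_sums[OF _ insert.IH] by simp
qed

text \<open>The inductive step needs a positive distance from \<open>- b\<close> to the span of
  \<open>B\<close>, which is not yet known to be closed. Combinations close to \<open>- b\<close>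
  have bounded norm, hence bounded coefficients by induction, so they lie in a compact cube that
  misses \<open>- b\<close>.\<close>

lemma coefficients_bounded:
  fixes B :: "'a::real_normed_vector set"
  assumes "finite B" "independent B"
  shows "\<exists>C\<ge>0. \<forall>a. \<forall>b\<in>B. \<bar>a b\<bar> \<le> C * norm (\<Sum>b\<in>B. a b *\<^sub>R b)"
  using assms
proof (induction B rule: finite_induct)
  case empty
  then show ?case by auto
next
  case (insert b B)
  let ?S = "\<lambda>a. \<Sum>c\<in>B. a c *\<^sub>R c"
  have indep: "independent B" and nspan: "b \<notin> span B"
    using insert.prems insert.hyps(2) by (simp_all add: independent_insert)
  obtain C where C: "C \<ge> 0" "\<And>a c. c \<in> B \<Longrightarrow> \<bar>a c\<bar> \<le> C * norm (?S a)"
    using insert.IH indep by blast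
  \<comment> \<open>If \<open>b + ?S a\<close> has norm below 1, then \<open>?S a\<close> has norm
    at most \<open>norm b + 1\<close>, and its coefficients are at most \<open>r\<close>.\<close>
  define r where "r = C * (norm b + 1)"
  let ?Q = "{?S a | a. \<forall>c\<in>B. \<bar>a c\<bar> \<le> r}"
  have S_span: "?S a \<in> span B" for a by (intro span_sum span_scale span_base)
  have "- b \<notin> ?Q"
  proof
    assume "- b \<in> ?Q"
    then obtain a where "- b = ?S a" by blast
    then have "- b \<in> span B" using S_span[of a] by argo
    then have "- (- b) \<in> span B" by (rule span_neg)
    then show False using nspan by (simp only: minus_minus)
  qed
  moreover have "closed ?Q" by (rule compact_imp_closed[OF compact_coefficient_cube[OF insert.hyps(1)]])
  ultimately have "open (- ?Q)" "- b \<in> - ?Q" by (auto simp only: open_Compl Compl_iff)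
  then obtain d where d: "d > 0" "ball (- b) d \<subseteq> - ?Q"
    by (meson open_contains_ball)
  define e where "e = min d 1"
  have e: "e > 0" using d by (simp add: e_def)
  have lower: "e \<le> norm (b + ?S a)" for a
  proof (cases "norm (b + ?S a) < 1")
    case True
    have "norm (?S a) \<le> norm (b + ?S a) + norm b" using norm_triangle_ineq4[of "b + ?S a" b] by simp
    then have "norm (?S a) \<le> norm b + 1" using True by simp
    then have "\<bar>a c\<bar> \<le> r" if "c \<in> B" for c
      using C(2)[OF that, of a] mult_left_mono[OF _ C(1)] unfolding r_def by (meson order_trans)
    then have "?S a \<in> ?Q" by blast
    then have "d \<le> norm (b + ?S a)"
      using d(2) by (force simp: dist_norm norm_minus_commute[of "- b"] add.commute)
    then show ?thesis by (simp add: e_def)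
  qed (simp add: e_def)
  have main: "e * \<bar>s\<bar> \<le> norm (s *\<^sub>R b + ?S a)" for s a
  proof (cases "s = 0")
    case False
    have "s *\<^sub>R b + ?S a = s *\<^sub>R (b + ?S (\<lambda>c. a c / s))"
      using False by (simp add: scaleR_add_right scaleR_sum_right)
    then show ?thesis using mult_left_mono[OF lower[of "\<lambda>c. a c / s"], of "\<bar>s\<bar>"] by (simp add: mult.commute)
  qed simp
  \<comment> \<open>The first bound serves the coefficient of \<open>b\<close>, the second those of
    \<open>B\<close>, obtained after subtracting \<open>a b *\<^sub>R b\<close> from the
    sum.\<close>
  define D where "D = max (1 / e) (C * (1 + norm b / e))"
  have "\<bar>a c\<bar> \<le> D * norm (\<Sum>c\<in>insert b B. a c *\<^sub>R c)" if c: "c \<in> insert b B" for a c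
  proof -
    let ?n = "norm (\<Sum>c\<in>insert b B. a c *\<^sub>R c)"
    have n: "?n = norm (a b *\<^sub>R b + ?S a)" using insert by simp
    have ab: "\<bar>a b\<bar> \<le> (1 / e) * ?n" using main[of "a b" a] n e by (simp add: field_simps)
    show ?thesis
    proof (cases "c = b")
      case True
      have "(1 / e) * ?n \<le> D * ?n" by (intro mult_right_mono) (auto simp: D_def)
      then show ?thesis using ab True by simp
    next
      case False
      have "norm (?S a) \<le> ?n + \<bar>a b\<bar> * norm b"
        using norm_triangle_ineq4[of "a b *\<^sub>R b + ?S a" "a b *\<^sub>R b"] n by simp
      also have "\<dots> \<le> ?n + (1 / e) * ?n * norm b" using mult_right_mono[OF ab, of "norm b"] by simp
      also have "\<dots> = (1 + norm b / e) * ?n" by (simp add: algebra_simps)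
      finally have "C * norm (?S a) \<le> C * ((1 + norm b / e) * ?n)" using C(1) mult_left_mono by blast
      also have "\<dots> \<le> D * ?n" unfolding mult.assoc[symmetric] by (intro mult_right_mono) (auto simp: D_def)
      finally show ?thesis using C(2)[of c a] c False by force
    qed
  qed
  moreover have "D \<ge> 0" using e by (simp add: D_def le_max_iff_disj)
  ultimately show ?case by blast
qed

section \<open>Coordinates with respect to a finite basis\<close>

locale finite_basis =
  fixes B :: "'a::real_normed_vector set"
  assumes finite_B: "finite B" and independent_B: "independent B" and span_B: "span B = UNIV"
begin

text \<open>For \<open>b\<close> in \<open>B\<close> this is the functional dual to
  \<open>b\<close>; the basis vector comes first so that \<open>coord b\<close> is a linear
  map.\<close>

definition coord :: "'a \<Rightarrow> 'a \<Rightarrow> real" where "coord b x = representation B x b"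

lemma coord_sum: "(\<Sum>b\<in>B. coord b x *\<^sub>R b) = x"
  unfolding coord_def using sum_representation_eq[OF independent_B _ finite_B] span_B by auto

lemma coord_linear: "linear (coord b)"
  unfolding coord_def using real_vector.linear_representation[OF independent_B span_B]
  by (simp add: linear_iff real_vector.representation_add[OF independent_B]
      real_vector.representation_scale[OF independent_B] span_B)

lemma coord_bound: obtains C where "C \<ge> 0" "\<And>b x. b \<in> B \<Longrightarrow> \<bar>coord b x\<bar> \<le> C * norm x"
proof -
  obtain C where "C \<ge> 0" "\<And>a b. b \<in> B \<Longrightarrow> \<bar>a b\<bar> \<le> C * norm (\<Sum>b\<in>B. a b *\<^sub>R b)"
    using coefficients_bounded[OF finite_B independent_B] by blast
  then show thesis using that[of C] coord_sum by metis
qed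

lemma coord_bounded_linear: assumes "b \<in> B" shows "bounded_linear (coord b)"
proof -
  obtain C where "\<And>x. \<bar>coord b x\<bar> \<le> C * norm x" using coord_bound assms by metis
  then show ?thesis
    using linear_conv_bounded_linear bounded_linear_intro[of "coord b" C] coord_linear
    by (simp add: linear_add linear_scale mult.commute)
qed

lemma linear_expand:
  assumes "linear f" shows "f x = (\<Sum>b\<in>B. coord b x *\<^sub>R f b)"
proof -
  have "f x = f (\<Sum>b\<in>B. coord b x *\<^sub>R b)" by (simp add: coord_sum)
  then show ?thesis using assms by (simp add: linear_sum linear_scale)
qed

lemma linear_bounded_linear:
  fixes f :: "'a \<Rightarrow> 'b::real_normed_vector"
  assumes "linear f" shows "bounded_linear f"
proof -
  have "(\<lambda>x. \<Sum>b\<in>B. coord b x *\<^sub>R f b) = f"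
    by (rule ext) (rule linear_expand[OF assms, symmetric])
  moreover have "bounded_linear (\<lambda>x. \<Sum>b\<in>B. coord b x *\<^sub>R f b)"
    by (intro bounded_linear_sum bounded_linear_scaleR_const coord_bounded_linear)
  ultimately show ?thesis by simp
qed

text \<open>The constant depends on the basis alone, not on \<open>f\<close>. Smallness on the
  finitely many basis vectors thus becomes a bound on the operator norm, which is how continuity of
  a derivative in each fixed direction is upgraded to uniformity over all directions.\<close>

lemma linear_small_on_basis:
  obtains C where "C > 0"
    "\<And>(f :: 'a \<Rightarrow> 'b::real_normed_vector) e x.
        linear f \<Longrightarrow> (\<And>b. b \<in> B \<Longrightarrow> norm (f b) \<le> e) \<Longrightarrow> norm (f x) \<le> e * C * norm x"
proof -
  obtain C where C: "C \<ge> 0" "\<And>b x. b \<in> B \<Longrightarrow> \<bar>coord b x\<bar> \<le> C * norm x" using coord_bound by blast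
  \<comment> \<open>The summand 1 makes the constant positive even for an empty basis; later choices
    of epsilon divide by it.\<close>
  define D where "D = real (card B) * C + 1"
  have "D > 0" using C by (simp add: D_def add_nonneg_pos)
  moreover have "norm (f x) \<le> e * D * norm x"
    if f: "linear f" "\<And>b. b \<in> B \<Longrightarrow> norm (f b) \<le> e" for f :: "'a \<Rightarrow> 'b" and e x
  proof (cases "B = {}")
    case True
    then have "x = 0" using coord_sum[of x] by simp
    then show ?thesis using f(1) by (simp add: linear_0)
  next
    case False
    \<comment> \<open>Only the presence of a basis vector forces \<open>e\<close> to be nonnegative,
      hence the case split.\<close>
    then have e: "e \<ge> 0" using f(2) norm_ge_zero order_trans by blast
    have "norm (f x) \<le> (\<Sum>b\<in>B. norm (coord b x *\<^sub>R f b))"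
      unfolding linear_expand[OF f(1), of x] by (rule norm_sum)
    also have "\<dots> \<le> (\<Sum>b\<in>B. C * norm x * e)"
      using C f(2) by (intro sum_mono) (auto intro!: mult_mono)
    also have "\<dots> = e * (real (card B) * C) * norm x" by simp
    also have "\<dots> \<le> e * D * norm x" using e by (intro mult_right_mono mult_left_mono) (auto simp: D_def)
    finally show ?thesis .
  qed
  ultimately show thesis by (rule that)
qed

lemma compact_cube: "compact {x. \<forall>b\<in>B. \<bar>coord b x\<bar> \<le> r}" (is "compact ?A")
proof -
  let ?Q = "{\<Sum>b\<in>B. a b *\<^sub>R b | a. \<forall>b\<in>B. \<bar>a b\<bar> \<le> r}"
  have "closed {x. \<bar>coord b x\<bar> \<le> r}" if "b \<in> B" for b
    by (intro closed_Collect_le continuous_intros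
        bounded_linear.continuous_on[OF coord_bounded_linear[OF that]])
  then have "closed (\<Inter>b\<in>B. {x. \<bar>coord b x\<bar> \<le> r})" by (intro closed_INT) auto
  moreover have "?A = (\<Inter>b\<in>B. {x. \<bar>coord b x\<bar> \<le> r})" by auto
  ultimately have "closed ?A" by argo
  then have "compact (?A \<inter> ?Q)"
    using compact_coefficient_cube[OF finite_B] by (rule closed_Int_compact)
  moreover have "?A \<subseteq> ?Q"
  proof
    fix x assume "x \<in> ?A"
    then have "\<forall>b\<in>B. \<bar>coord b x\<bar> \<le> r" by simp
    then show "x \<in> ?Q"
      by (intro CollectI exI[of _ "\<lambda>b. coord b x"] conjI coord_sum[symmetric])
  qed
  ultimately show ?thesis by (simp only: Int_absorb2)
qed

text \<open>The coordinates of a Cauchy sequence are real Cauchy sequences, and their limits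
  reassemble. Completeness serves the fixed point argument in \<open>local_inverse\<close>.\<close>

lemma complete_UNIV_finite_dim: "complete (UNIV :: 'a set)"
proof (rule completeI)
  fix x :: "nat \<Rightarrow> 'a" assume x: "Cauchy x"
  have "\<exists>l. (\<lambda>n. coord b (x n)) \<longlonglongrightarrow> l" if "b \<in> B" for b
    using bounded_linear.Cauchy[OF coord_bounded_linear[OF that] x] Cauchy_convergent convergent_def by blast
  then obtain l where l: "\<And>b. b \<in> B \<Longrightarrow> (\<lambda>n. coord b (x n)) \<longlonglongrightarrow> l b" by metis
  then have "(\<lambda>n. \<Sum>b\<in>B. coord b (x n) *\<^sub>R b) \<longlonglongrightarrow> (\<Sum>b\<in>B. l b *\<^sub>R b)"
    by (intro tendsto_sum tendsto_scaleR tendsto_const)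
  then show "\<exists>l\<in>UNIV. x \<longlonglongrightarrow> l" by (auto simp: coord_sum)
qed

lemma linear_inj_surj:
  fixes f :: "'a \<Rightarrow> 'a"
  assumes "linear f" "inj f" shows "surj f"
proof -
  interpret finite_dimensional_vector_space "scaleR :: real \<Rightarrow> 'a \<Rightarrow> 'a" B
    using finite_B independent_B span_B
    by unfold_locales (auto simp: dependent_raw_def span_raw_def algebra_simps)
  show ?thesis using linear_inj_imp_surj assms unfolding linear_def by blast
qed

end

lemma finite_basis_exists:
  fixes S :: "'a::real_normed_vector set"
  assumes "finite S" "span S = UNIV"
  obtains B :: "'a set" where "finite_basis B"
proof -
  obtain B where "B \<subseteq> S" "independent B" "S \<subseteq> span B" using maximal_independent_subset by metis
  then have "finite_basis B"
    using assms by (metis finite_basis.intro finite_subset span_mono span_span top.extremum_uniqueI)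
  then show thesis by (rule that)
qed

text \<open>Components of a time-dependent field are functions on a model space times the time axis;
  composing them with a change of coordinates uses a basis of that product.\<close>

lemma finite_basis_Pair_real:
  fixes B :: "'a::real_normed_vector set"
  assumes "finite_basis B"
  obtains C :: "('a \<times> real) set" where "finite_basis C"
proof -
  interpret finite_basis B by fact
  let ?S = "insert (0, 1) ((\<lambda>b. (b, 0)) ` B) :: ('a \<times> real) set"
  have "(x, t) \<in> span ?S" for x t
  proof -
    have "(x, t) = (\<Sum>b\<in>B. coord b x *\<^sub>R (b, 0)) + t *\<^sub>R (0, 1)"
      by (simp add: prod_eq_iff fst_sum snd_sum coord_sum)
    moreover have "\<dots> \<in> span ?S" by (intro span_add span_sum span_scale span_base) auto
    ultimately show ?thesis by metis
  qed
  then have "span ?S = UNIV" by auto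
  then show thesis using finite_basis_exists[of ?S] finite_B that by blast
qed


section \<open>Calculus of smooth maps\<close>

lemma Ck_on_has_derivative:
  assumes "Ck_on (Suc k) f S" "x \<in> S"
  shows "(f has_derivative frechet_derivative f (at x)) (at x)"
  using assms by (simp add: frechet_derivative_works)

lemma Ck_on_derivative: "Ck_on (Suc k) f S \<Longrightarrow> Ck_on k (\<lambda>x. frechet_derivative f (at x) v) S"
  by simp

lemma Ck_on_cong:
  assumes "open S" "Ck_on k f S" "\<And>x. x \<in> S \<Longrightarrow> f x = g x"
  shows "Ck_on k g S"
  using assms(2,3)
proof (induction k arbitrary: f g)
  case 0
  then show ?case using continuous_on_cong by (metis Ck_on.simps(1))
next
  case (Suc k)
  have g': "(g has_derivative frechet_derivative f (at x)) (at x)" if "x \<in> S" for x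
    using has_derivative_transform_within_open[OF Ck_on_has_derivative[OF Suc.prems(1) that] assms(1) that]
      Suc.prems(2) by blast
  have "Ck_on k (\<lambda>x. frechet_derivative g (at x) v) S" for v
    by (rule Suc.IH[OF Ck_on_derivative[OF Suc.prems(1), of v]]) (use g' frechet_derivative_at in metis)
  then show ?case using g' by (auto intro: differentiableI)
qed

text \<open>Derivatives at interior points are unique, so an explicit formula \<open>f'\<close> may
  stand in for the chosen \<open>frechet_derivative\<close> in inductions on the order.\<close>

lemma Ck_on_SucI:
  assumes "\<And>x. x \<in> S \<Longrightarrow> (f has_derivative f' x) (at x)"
    and "\<And>v. Ck_on k (\<lambda>x. f' x v) S" and "open S"
  shows "Ck_on (Suc k) f S"
proof -
  have "Ck_on k (\<lambda>x. frechet_derivative f (at x) v) S" for v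
    by (rule Ck_on_cong[OF assms(3) assms(2)[of v]]) (use assms(1) frechet_derivative_at in metis)
  then show ?thesis using assms(1) by (auto intro: differentiableI)
qed

lemma Ck_on_continuous: "Ck_on k f S \<Longrightarrow> continuous_on S f"
  by (cases k)
    (auto intro!: continuous_at_imp_continuous_on differentiable_imp_continuous_within)

lemma Ck_on_Suc_imp: "Ck_on (Suc k) f S \<Longrightarrow> Ck_on k f S"
proof (induction k arbitrary: f)
  case 0
  then show ?case using Ck_on_continuous by (metis Ck_on.simps(1))
next
  case (Suc k)
  then show ?case
    unfolding Ck_on.simps(2)[of "Suc k"] Ck_on.simps(2)[of k f] using Suc.IH by blast
qed

lemma Ck_on_subset: "Ck_on k f S \<Longrightarrow> T \<subseteq> S \<Longrightarrow> Ck_on k f T"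
  by (induction k arbitrary: f) (auto intro: continuous_on_subset)

lemma Ck_on_locally:
  assumes "\<And>x. x \<in> S \<Longrightarrow> \<exists>T. open T \<and> x \<in> T \<and> Ck_on k f T"
  shows "Ck_on k f S"
  using assms
proof (induction k arbitrary: f)
  case 0
  then have "isCont f x" if "x \<in> S" for x
    using that continuous_on_eq_continuous_at Ck_on.simps(1) by metis
  then show ?case by (simp add: continuous_at_imp_continuous_on)
next
  case (Suc k)
  have "f differentiable (at x)" if "x \<in> S" for x
    using Suc.prems[OF that] Ck_on.simps(2) by blast
  moreover have "Ck_on k (\<lambda>x. frechet_derivative f (at x) v) S" for v
    by (rule Suc.IH) (use Suc.prems Ck_on_derivative in metis)
  ultimately show ?case by simp
qed

lemma Ck_on_const: "Ck_on k (\<lambda>x. c) S"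
proof (induction k arbitrary: c)
  case (Suc k)
  have "frechet_derivative (\<lambda>x. c) (at x) v = 0" for x v
    using frechet_derivative_at[OF has_derivative_const] by metis
  then show ?case using Suc by simp
qed simp

lemma Ck_on_bounded_linear:
  assumes "bounded_linear f" shows "Ck_on k f S"
proof (cases k)
  case 0
  then show ?thesis using assms by (simp add: linear_continuous_on)
next
  case (Suc j)
  have "frechet_derivative f (at x) v = f v" for x v
    using frechet_derivative_at[OF bounded_linear_imp_has_derivative[OF assms]] by metis
  then show ?thesis
    using Suc assms by (simp add: Ck_on_const bounded_linear_imp_differentiable)
qed

lemma Ck_on_linear_compose:
  assumes "bounded_linear L" "open S" "Ck_on k f S"
  shows "Ck_on k (\<lambda>x. L (f x)) S"
  using assms(3)
proof (induction k arbitrary: f)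
  case 0
  then show ?case using bounded_linear.continuous_on[OF assms(1)] by simp
next
  case (Suc k)
  show ?case
    by (rule Ck_on_SucI[OF bounded_linear.has_derivative[OF assms(1) Ck_on_has_derivative[OF Suc.prems]] _ assms(2)])
      (use Suc in \<open>auto simp del: Ck_on.simps intro: Ck_on_derivative\<close>)
qed

lemma Ck_on_add:
  assumes "open S" "Ck_on k f S" "Ck_on k g S"
  shows "Ck_on k (\<lambda>x. f x + g x) S"
  using assms(2,3)
proof (induction k arbitrary: f g)
  case 0
  then show ?case by (auto intro: continuous_on_add)
next
  case (Suc k)
  show ?case
    by (rule Ck_on_SucI[OF has_derivative_add[OF Ck_on_has_derivative[OF Suc.prems(1)] Ck_on_has_derivative[OF Suc.prems(2)]] _ assms(1)])
      (use Suc in \<open>auto simp del: Ck_on.simps intro: Ck_on_derivative\<close>)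
qed

lemma Ck_on_sum:
  assumes "open S" "\<And>i. i \<in> A \<Longrightarrow> Ck_on k (f i) S"
  shows "Ck_on k (\<lambda>x. \<Sum>i\<in>A. f i x) S"
  using assms(2)
  by (induction A rule: infinite_finite_induct) (auto intro: Ck_on_add assms(1) Ck_on_const)

text \<open>The product rule returns a sum of two terms of the same shape with one factor
  differentiated, so the induction closes when it ranges over all pairs of functions.\<close>

lemma Ck_on_bilinear:
  assumes "bounded_bilinear p" "open S" "Ck_on k f S" "Ck_on k g S"
  shows "Ck_on k (\<lambda>x. p (f x) (g x)) S"
  using assms(3,4)
proof (induction k arbitrary: f g)
  case 0
  then show ?case using bounded_bilinear.continuous_on[OF assms(1)] by simp
next
  case (Suc k)
  show ?case
  proof (rule Ck_on_SucI[OF bounded_bilinear.FDERIV[OF assms(1) Ck_on_has_derivative[OF Suc.prems(1)] Ck_on_has_derivative[OF Suc.prems(2)]] _ assms(2)])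
    fix v
    show "Ck_on k (\<lambda>x. p (f x) (frechet_derivative g (at x) v) + p (frechet_derivative f (at x) v) (g x)) S"
      by (intro Ck_on_add assms(2) Suc.IH Suc.prems[THEN Ck_on_derivative] Suc.prems[THEN Ck_on_Suc_imp])
  qed
qed

lemmas Ck_on_scaleR = Ck_on_bilinear[OF bounded_bilinear_scaleR]
lemmas Ck_on_mult = Ck_on_bilinear[OF bounded_bilinear_mult]

lemma Ck_on_diff:
  assumes "open S" "Ck_on k f S" "Ck_on k g S"
  shows "Ck_on k (\<lambda>x. f x - g x) S"
  using Ck_on_add[OF assms(1,2) Ck_on_linear_compose[OF bounded_linear_minus[OF bounded_linear_ident] assms(1,3)]]
  by simp

lemma Ck_on_Pair:
  assumes "open S" "Ck_on k f S" "Ck_on k g S"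
  shows "Ck_on k (\<lambda>x. (f x, g x)) S"
proof -
  have "Ck_on k (\<lambda>x. (f x, 0) + (0, g x)) S"
    by (intro Ck_on_add assms Ck_on_linear_compose[of "\<lambda>x. (x, 0)"] Ck_on_linear_compose[of "\<lambda>x. (0, x)"]
        bounded_linear_Pair bounded_linear_ident bounded_linear_zero)
  then show ?thesis by simp
qed

lemma diff_split: "a - c = a - b + (b - c)" for a b c :: "'a::ab_group_add"
  by simp

section \<open>Chain rule and inversion of linear maps depending on a parameter\<close>

context finite_basis
begin

lemma has_derivative_expand:
  assumes "(g has_derivative g') F"
  shows "g' x = (\<Sum>b\<in>B. coord b x *\<^sub>R g' b)"
  using assms by (intro linear_expand has_derivative_linear)

lemma Ck_on_coord:
  assumes "b \<in> B" "open S" "Ck_on k f S"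
  shows "Ck_on k (\<lambda>x. coord b (f x)) S"
  using Ck_on_linear_compose[OF coord_bounded_linear] assms by blast

text \<open>The directional derivatives of a composition are no compositions; expanding the inner
  derivative in a basis turns them into sums of products of such.\<close>

lemma Ck_on_compose:
  fixes f :: "'c::real_normed_vector \<Rightarrow> 'a" and g :: "'a \<Rightarrow> 'd::real_normed_vector"
  assumes "open S" "open T" "f ` S \<subseteq> T" "Ck_on k f S" "Ck_on k g T"
  shows "Ck_on k (\<lambda>x. g (f x)) S"
  using assms(4,5)
proof (induction k arbitrary: g)
  case 0
  then show ?case using assms(3) continuous_on_compose2 by (metis Ck_on.simps(1))
next
  case (Suc k)
  have fT: "f x \<in> T" if "x \<in> S" for x using assms(3) that by blast
  let ?f' = "\<lambda>x. frechet_derivative f (at x)" and ?g' = "\<lambda>x. frechet_derivative g (at x)"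
  show ?case
  proof (rule Ck_on_SucI[OF _ _ assms(1)])
    fix x assume x: "x \<in> S"
    show "((\<lambda>x. g (f x)) has_derivative (\<lambda>v. \<Sum>b\<in>B. coord b (?f' x v) *\<^sub>R ?g' (f x) b)) (at x)"
      by (rule has_derivative_eq_rhs[OF has_derivative_compose[OF Ck_on_has_derivative[OF Suc.prems(1) x]
              Ck_on_has_derivative[OF Suc.prems(2) fT[OF x]]]])
        (rule ext, rule has_derivative_expand[OF Ck_on_has_derivative[OF Suc.prems(2) fT[OF x]]])
  next
    fix v
    show "Ck_on k (\<lambda>x. \<Sum>b\<in>B. coord b (?f' x v) *\<^sub>R ?g' (f x) b) S"
      by (intro Ck_on_sum Ck_on_scaleR Ck_on_coord assms(1) Suc.IH[OF Ck_on_Suc_imp[OF Suc.prems(1)]]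
          Ck_on_derivative[OF Suc.prems(1)] Ck_on_derivative[OF Suc.prems(2)])
  qed
qed

text \<open>The bound forces a trivial kernel, and equality of dimensions does the rest.\<close>

lemma bij_of_lower_bound:
  fixes A :: "'a \<Rightarrow> 'a"
  assumes "linear A" "\<And>u. norm u \<le> K * norm (A u)"
  shows "bij A" "linear (inv_into UNIV A)"
proof -
  have "inj A"
    using assms by (metis linear_inj_iff_eq_0 mult_zero_right norm_le_zero_iff norm_zero)
  then show "bij A" using linear_inj_surj assms(1) by (simp add: bij_def)
  then show "linear (inv_into UNIV A)"
    using assms(1) by (simp add: bij_def linear_iff inv_f_eq surj_f_inv_f)
qed

text \<open>With \<open>J\<close> the inverse of \<open>A\<close>, the identity
  \<open>J_diff\<close> reads \<open>J y - J z = J y (A z - A y) J z\<close>. Together with the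
  uniform bound on the inverses it gives continuity of \<open>J\<close> and then its derivative
  \<open>- J A' J\<close>. That formula involves only \<open>J\<close> and the derivative of
  \<open>A\<close>, so order \<open>k\<close> of \<open>J\<close> yields order
  \<open>k + 1\<close>.\<close>

lemma Ck_on_linear_inverse:
  fixes A :: "'c::real_normed_vector \<Rightarrow> 'a \<Rightarrow> 'a"
  assumes "open S" and lin: "\<And>y. y \<in> S \<Longrightarrow> linear (A y)"
    and lower: "\<And>y u. y \<in> S \<Longrightarrow> norm u \<le> K * norm (A y u)"
    and Ck: "\<And>b. b \<in> B \<Longrightarrow> Ck_on k (\<lambda>y. A y b) S"
  shows "Ck_on k (\<lambda>y. inv_into UNIV (A y) v) S"
proof -
  define J where "J y = inv_into UNIV (A y)" for y
  have bij: "bij (A y)" if "y \<in> S" for y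
    using bij_of_lower_bound(1)[OF lin[OF that] lower[OF that]] .
  have AJ: "A y (J y u) = u" and JA: "J y (A y u) = u" if "y \<in> S" for y u
    using bij[OF that] by (simp_all add: J_def bij_is_surj surj_f_inv_f bij_is_inj)
  have linJ: "linear (J y)" if "y \<in> S" for y
    unfolding J_def using bij_of_lower_bound(2)[OF lin[OF that] lower[OF that]] .
  have normJ: "norm (J y u) \<le> K * norm u" if "y \<in> S" for y u
    using lower[OF that, of "J y u"] AJ[OF that] by simp
  \<comment> \<open>\<open>K\<close> may fail to be positive, for instance on the trivial space, and
    \<open>e1\<close> below divides by the bound.\<close>
  define K' where "K' = max K 1"
  have K': "K' > 0" by (simp add: K'_def)
  have normJ: "norm (J y u) \<le> K' * norm u" if "y \<in> S" for y u
    using normJ[OF that, of u] mult_right_mono[of K K' "norm u"] by (simp add: K'_def)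
  have J_diff: "J y v - J z v = J y (A z (J z v) - A y (J z v))" if "y \<in> S" "z \<in> S" for y z v
    using AJ JA that linear_diff[OF linJ[OF that(1)]] by simp
  have Ck_A: "Ck_on k (\<lambda>y. A y u) S" if "\<And>b. b \<in> B \<Longrightarrow> Ck_on k (\<lambda>y. A y b) S" for u k
    by (rule Ck_on_cong[OF assms(1), of k "\<lambda>y. \<Sum>b\<in>B. coord b u *\<^sub>R A y b"])
      (use that lin linear_expand[of "A _" u] in \<open>auto intro!: Ck_on_sum Ck_on_scaleR Ck_on_const assms(1)\<close>)
  have cont: "continuous_on S (\<lambda>y. J y v)" if "\<And>b. b \<in> B \<Longrightarrow> Ck_on 0 (\<lambda>y. A y b) S" for v
    unfolding continuous_on_def
  proof
    fix z assume z: "z \<in> S"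
    let ?R = "\<lambda>y. A z (J z v) - A y (J z v)"
    have "continuous_on S (\<lambda>y. A y (J z v))" using Ck_A[OF that] by simp
    then have "((\<lambda>y. K' * norm (?R y)) \<longlongrightarrow> K' * norm (?R z)) (at z within S)"
      using z unfolding continuous_on_def by (intro tendsto_intros) auto
    then have "((\<lambda>y. K' * norm (?R y)) \<longlongrightarrow> 0) (at z within S)" by simp
    then have "((\<lambda>y. J y v - J z v) \<longlongrightarrow> 0) (at z within S)"
      by (rule Lim_null_comparison[rotated])
        (use J_diff z normJ in \<open>auto simp: eventually_at_filter\<close>)
    then show "((\<lambda>y. J y v) \<longlongrightarrow> J z v) (at z within S)" by (simp add: LIM_zero_iff)
  qed
  have "Ck_on k (\<lambda>y. J y v) S" for v
    using Ck
  proof (induction k arbitrary: v)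
    case 0
    then show ?case using cont by simp
  next
    case (Suc k)
    have Ck_A': "Ck_on (Suc k) (\<lambda>y. A y u) S" for u by (rule Ck_A[OF Suc.prems])
    have Ck_J: "Ck_on k (\<lambda>y. J y u) S" for u
      by (intro Suc.IH) (use Suc.prems Ck_on_Suc_imp in blast)
    have contJ: "continuous_on S (\<lambda>y. J y u)" for u by (rule Ck_on_continuous[OF Ck_J])
    let ?A' = "\<lambda>u z. frechet_derivative (\<lambda>y. A y u) (at z)"
    show ?case
    proof (rule Ck_on_SucI[OF _ _ assms(1)])
      fix z assume z: "z \<in> S"
      let ?u = "J z v"
      let ?R = "\<lambda>y. A z ?u - A y ?u"
      let ?R' = "\<lambda>h. - ?A' ?u z h"
      have R': "(?R has_derivative ?R') (at z)"
        using has_derivative_diff[OF has_derivative_const Ck_on_has_derivative[OF Ck_A' z]] by simp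
      have bl: "bounded_linear ?R'" using R' by (rule has_derivative_bounded_linear)
      obtain M where M: "M > 0" "\<And>h. norm (?R' h) \<le> norm h * M"
        using bounded_linear.pos_bounded[OF bl] by blast
      obtain C where C: "C > 0"
        "\<And>(f :: 'a \<Rightarrow> 'a) e x. linear f \<Longrightarrow> (\<And>b. b \<in> B \<Longrightarrow> norm (f b) \<le> e) \<Longrightarrow> norm (f x) \<le> e * C * norm x"
        using linear_small_on_basis[where 'b = 'a] by blast
      show "((\<lambda>y. J y v) has_derivative (\<lambda>h. J z (?R' h))) (at z)"
        unfolding has_derivative_within_alt2
      proof (intro conjI allI impI)
        show "bounded_linear (\<lambda>h. J z (?R' h))"
          using bounded_linear_compose[OF linear_bounded_linear[OF linJ[OF z]] bl] .
        fix e :: real assume e: "e > 0"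
        \<comment> \<open>The constants are chosen so that each of the two error terms below is at
          most half of \<open>e * norm (y - z)\<close>.\<close>
        define e1 where "e1 = e / (2 * K')"
        define e2 where "e2 = e / (2 * C * M)"
        have e12: "e1 > 0" "e2 > 0" using e K' C(1) M(1) by (simp_all add: e1_def e2_def)
        have "eventually (\<lambda>y. norm (?R y - ?R z - ?R' (y - z)) \<le> e1 * norm (y - z)) (at z)"
          using R' e12 unfolding has_derivative_within_alt2 by blast
        \<comment> \<open>The vector \<open>?R' (y - z)\<close> moves with \<open>y\<close>, so
          continuity of \<open>J\<close> at a fixed vector does not suffice; closeness on the basis
          controls all vectors at once.\<close>
        moreover have "eventually (\<lambda>y. \<forall>b\<in>B. norm (J y b - J z b) \<le> e2) (at z)"
        proof (rule eventually_ball_finite[OF finite_B ballI])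
          fix b assume "b \<in> B"
          have "isCont (\<lambda>y. J y b) z" using contJ z assms(1) continuous_on_eq_continuous_at by blast
          then have "eventually (\<lambda>y. dist (J y b) (J z b) < e2) (at z)"
            unfolding isCont_def by (rule tendstoD[OF _ e12(2)])
          then show "eventually (\<lambda>y. norm (J y b - J z b) \<le> e2) (at z)"
            by eventually_elim (simp add: dist_norm)
        qed
        moreover have "eventually (\<lambda>y. y \<in> S) (at z)"
          using z assms(1) by (rule eventually_at_in_open'[rotated])
        ultimately show "eventually (\<lambda>y. norm (J y v - J z v - J z (?R' (y - z))) \<le> e * norm (y - z)) (at z)"
        proof eventually_elim
          case (elim y)
          let ?w = "?R' (y - z)"
          \<comment> \<open>One term carries the linearisation error of \<open>A\<close> at
            \<open>z\<close>, the other the replacement of \<open>J y\<close> by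
            \<open>J z\<close>.\<close>
          have "J y v - J z v - J z ?w = J y (?R y - ?w) + (J y ?w - J z ?w)"
            unfolding J_diff[OF elim(3) z, of v] linear_diff[OF linJ[OF elim(3)], of "?R y" ?w]
            by (rule diff_split)
          then have "norm (J y v - J z v - J z ?w) \<le> norm (J y (?R y - ?w)) + norm (J y ?w - J z ?w)"
            using norm_triangle_ineq by metis
          moreover have "norm (J y (?R y - ?w)) \<le> K' * (e1 * norm (y - z))"
          proof (rule order_trans[OF normJ[OF elim(3)] mult_left_mono])
            show "norm (?R y - ?w) \<le> e1 * norm (y - z)"
              using elim(1) by (simp only: diff_self diff_zero)
          qed (use K' in simp)
          moreover have "norm (J y ?w - J z ?w) \<le> e2 * C * (norm (y - z) * M)"
          proof -
            have "linear (\<lambda>w. J y w - J z w)" by (intro linear_compose_sub linJ elim(3) z)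
            then have "norm (J y ?w - J z ?w) \<le> e2 * C * norm ?w" by (rule C(2)) (use elim(2) in blast)
            also have "\<dots> \<le> e2 * C * (norm (y - z) * M)"
              using M(2) e12 C(1) by (intro mult_left_mono) auto
            finally show ?thesis .
          qed
          moreover have "K' * (e1 * norm (y - z)) + e2 * C * (norm (y - z) * M) = e * norm (y - z)"
            using K' C(1) M(1) by (simp add: e1_def e2_def field_simps)
          ultimately show ?case by linarith
        qed
      qed
    next
      fix h
      \<comment> \<open>Both \<open>J z\<close> and the derivative of \<open>A\<close> are applied
        to vectors that depend on \<open>z\<close>. Expanding these leaves scalar coefficients times
        values at fixed basis vectors, to which the induction hypothesis applies.\<close>
      have "Ck_on k (\<lambda>z. \<Sum>c\<in>B. coord c (- (\<Sum>b\<in>B. coord b (J z v) *\<^sub>R ?A' b z h)) *\<^sub>R J z c) S"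
        using Ck_on_derivative[OF Ck_A']
        by (intro Ck_on_sum Ck_on_scaleR Ck_on_coord Ck_on_linear_compose[OF bounded_linear_minus[OF bounded_linear_ident]] assms(1) Ck_J)
      then show "Ck_on k (\<lambda>z. J z (- ?A' (J z v) z h)) S"
      proof (rule Ck_on_cong[OF assms(1)])
        fix z assume z: "z \<in> S"
        have "((\<lambda>y. \<Sum>b\<in>B. coord b (J z v) *\<^sub>R A y b) has_derivative
            (\<lambda>h. \<Sum>b\<in>B. coord b (J z v) *\<^sub>R ?A' b z h)) (at z)"
          using Ck_on_has_derivative[OF Ck_A' z] by (auto intro!: derivative_eq_intros)
        then have D: "((\<lambda>y. A y (J z v)) has_derivative (\<lambda>h. \<Sum>b\<in>B. coord b (J z v) *\<^sub>R ?A' b z h)) (at z)"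
          by (rule has_derivative_transform_within_open[OF _ assms(1) z])
            (rule linear_expand[OF lin, symmetric])
        have "?A' (J z v) z h = (\<Sum>b\<in>B. coord b (J z v) *\<^sub>R ?A' b z h)"
          by (rule fun_cong[OF frechet_derivative_at[OF D, symmetric]])
        then show "(\<Sum>c\<in>B. coord c (- (\<Sum>b\<in>B. coord b (J z v) *\<^sub>R ?A' b z h)) *\<^sub>R J z c) = J z (- ?A' (J z v) z h)"
          using linear_expand[OF linJ[OF z], of "- ?A' (J z v) z h"] by simp
      qed
    qed
  qed
  then show ?thesis unfolding J_def .
qed

end

section \<open>Smoothness, deduced order by order\<close>

lemma smooth_onI: "(\<And>k. Ck_on k f S) \<Longrightarrow> smooth_on f S"
  by (simp add: smooth_on_def)

lemma smooth_onD: "smooth_on f S \<Longrightarrow> Ck_on k f S"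
  by (simp add: smooth_on_def)

lemma smooth_on_cong:
  "open S \<Longrightarrow> smooth_on f S \<Longrightarrow> (\<And>x. x \<in> S \<Longrightarrow> f x = g x) \<Longrightarrow> smooth_on g S"
  by (rule smooth_onI, erule Ck_on_cong, erule smooth_onD)

lemma smooth_on_subset: "smooth_on f S \<Longrightarrow> T \<subseteq> S \<Longrightarrow> smooth_on f T"
  by (rule smooth_onI, rule Ck_on_subset, erule smooth_onD)

lemma smooth_on_locally:
  assumes "\<And>x. x \<in> S \<Longrightarrow> \<exists>T. open T \<and> x \<in> T \<and> smooth_on f T"
  shows "smooth_on f S"
  by (rule smooth_onI, rule Ck_on_locally) (use assms smooth_onD in blast)

lemma smooth_on_continuous: "smooth_on f S \<Longrightarrow> continuous_on S f"
  using Ck_on_continuous smooth_onD by blast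

lemma smooth_on_has_derivative:
  "smooth_on f S \<Longrightarrow> x \<in> S \<Longrightarrow> (f has_derivative frechet_derivative f (at x)) (at x)"
  by (rule Ck_on_has_derivative[OF smooth_onD])

lemma smooth_on_derivative: "smooth_on f S \<Longrightarrow> smooth_on (\<lambda>x. frechet_derivative f (at x) v) S"
  using Ck_on_derivative unfolding smooth_on_def by blast

lemma smooth_on_const: "smooth_on (\<lambda>x. c) S"
  by (rule smooth_onI, rule Ck_on_const)

lemma smooth_on_bounded_linear: "bounded_linear f \<Longrightarrow> smooth_on f S"
  by (rule smooth_onI, rule Ck_on_bounded_linear)

lemma smooth_on_ident: "smooth_on (\<lambda>x. x) S"
  by (intro smooth_on_bounded_linear bounded_linear_ident)

lemma smooth_on_linear_compose:
  "bounded_linear L \<Longrightarrow> open S \<Longrightarrow> smooth_on f S \<Longrightarrow> smooth_on (\<lambda>x. L (f x)) S"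
  by (rule smooth_onI, rule Ck_on_linear_compose) (simp_all add: smooth_onD)

lemma smooth_on_add:
  "open S \<Longrightarrow> smooth_on f S \<Longrightarrow> smooth_on g S \<Longrightarrow> smooth_on (\<lambda>x. f x + g x) S"
  by (rule smooth_onI, rule Ck_on_add) (simp_all add: smooth_onD)

lemma smooth_on_diff:
  "open S \<Longrightarrow> smooth_on f S \<Longrightarrow> smooth_on g S \<Longrightarrow> smooth_on (\<lambda>x. f x - g x) S"
  by (rule smooth_onI, rule Ck_on_diff) (simp_all add: smooth_onD)

lemma smooth_on_sum:
  "open S \<Longrightarrow> (\<And>i. i \<in> A \<Longrightarrow> smooth_on (f i) S) \<Longrightarrow> smooth_on (\<lambda>x. \<Sum>i\<in>A. f i x) S"
  by (rule smooth_onI, rule Ck_on_sum) (simp_all add: smooth_onD)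

lemma smooth_on_scaleR:
  "open S \<Longrightarrow> smooth_on f S \<Longrightarrow> smooth_on g S \<Longrightarrow> smooth_on (\<lambda>x. f x *\<^sub>R g x) S"
  by (rule smooth_onI, rule Ck_on_scaleR) (simp_all add: smooth_onD)

lemma smooth_on_mult:
  fixes f g :: "'a::real_normed_vector \<Rightarrow> 'b::real_normed_algebra"
  shows "open S \<Longrightarrow> smooth_on f S \<Longrightarrow> smooth_on g S \<Longrightarrow> smooth_on (\<lambda>x. f x * g x) S"
  by (rule smooth_onI, rule Ck_on_mult) (simp_all add: smooth_onD)

lemma smooth_on_Pair:
  "open S \<Longrightarrow> smooth_on f S \<Longrightarrow> smooth_on g S \<Longrightarrow> smooth_on (\<lambda>x. (f x, g x)) S"
  by (rule smooth_onI, rule Ck_on_Pair) (simp_all add: smooth_onD)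

lemma (in finite_basis) smooth_on_compose:
  fixes f :: "'c::real_normed_vector \<Rightarrow> 'a" and g :: "'a \<Rightarrow> 'd::real_normed_vector"
  assumes "open S" "open T" "f ` S \<subseteq> T" "smooth_on f S" "smooth_on g T"
  shows "smooth_on (\<lambda>x. g (f x)) S"
  by (rule smooth_onI, rule Ck_on_compose[OF assms(1-3)]) (use assms in \<open>auto intro: smooth_onD\<close>)

lemma (in finite_basis) smooth_on_coord:
  "b \<in> B \<Longrightarrow> open S \<Longrightarrow> smooth_on f S \<Longrightarrow> smooth_on (\<lambda>x. coord b (f x)) S"
  by (rule smooth_on_linear_compose[OF coord_bounded_linear])

text \<open>Here base point and direction vary together. Linearity in the direction reduces this to
  derivatives along basis vectors. It is the form in which a pushed-forward field appears in
  charts.\<close>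

lemma (in finite_basis) smooth_on_joint_derivative:
  fixes f :: "'a \<Rightarrow> 'b::real_normed_vector" and g h :: "'c::real_normed_vector \<Rightarrow> 'a"
  assumes "open S" "open T" "g ` S \<subseteq> T" "smooth_on g S" "smooth_on f T" "smooth_on h S"
  shows "smooth_on (\<lambda>x. frechet_derivative f (at (g x)) (h x)) S"
proof -
  have "smooth_on (\<lambda>x. frechet_derivative f (at (g x)) b) S" for b
    by (rule smooth_on_compose[OF assms(1-4) smooth_on_derivative[OF assms(5)]])
  then have "smooth_on (\<lambda>x. \<Sum>b\<in>B. coord b (h x) *\<^sub>R frechet_derivative f (at (g x)) b) S"
    by (intro smooth_on_sum smooth_on_scaleR smooth_on_coord assms)
  then show ?thesis
  proof (rule smooth_on_cong[OF assms(1)])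
    fix x assume "x \<in> S"
    then have "(f has_derivative frechet_derivative f (at (g x))) (at (g x))"
      using assms by (intro smooth_on_has_derivative) auto
    then show "(\<Sum>b\<in>B. coord b (h x) *\<^sub>R frechet_derivative f (at (g x)) b)
        = frechet_derivative f (at (g x)) (h x)"
      by (rule has_derivative_expand[symmetric])
  qed
qed


section \<open>Bump functions\<close>

text \<open>The factor \<open>1 / t\<^sup>n\<close> makes the span of these functions closed under differentiation.\<close>

definition flat :: "nat \<Rightarrow> real \<Rightarrow> real" where
  "flat n t = (if t > 0 then exp (- (1 / t)) / t ^ n else 0)"

text \<open>The substitution of \<open>1 / t\<close> turns the limit from the right into the decay
  of \<open>x ^ n / exp x\<close> at infinity.\<close>

lemma flat_tendsto_0: "(flat n \<longlongrightarrow> 0) (at 0)"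
proof -
  have "((\<lambda>t. inverse t ^ n / exp (inverse t)) \<longlongrightarrow> 0) (at_right (0::real))"
    using filterlim_compose[OF tendsto_power_div_exp_0 filterlim_inverse_at_top_right] .
  moreover have "eventually (\<lambda>t. inverse t ^ n / exp (inverse t) = flat n t) (at_right 0)"
    unfolding eventually_at_right_field
    by (intro exI[of _ 1]) (auto simp: flat_def exp_minus field_simps)
  ultimately have "(flat n \<longlongrightarrow> 0) (at_right 0)" by (rule Lim_transform_eventually)
  moreover have "(flat n \<longlongrightarrow> 0) (at_left 0)"
    by (rule Lim_transform_eventually[OF tendsto_const])
      (auto simp: eventually_at_left_field flat_def intro!: exI[of _ "-1"])
  ultimately show ?thesis by (simp add: filterlim_split_at)
qed

lemma flat_has_derivative:
  "(flat n has_real_derivative flat (n + 2) t - real n * flat (n + 1) t) (at t)"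
proof -
  consider "t > 0" | "t < 0" | "t = 0" by linarith
  then show ?thesis
  proof cases
    case 1
    have pow: "((\<lambda>t. t ^ n) has_real_derivative real n * t ^ n / t) (at t)"
      using DERIV_pow[of n t UNIV] 1 by (cases n) auto
    have exp: "((\<lambda>t. exp (- (1 / t))) has_real_derivative exp (- (1 / t)) / t\<^sup>2) (at t)"
      using 1 by (auto intro!: derivative_eq_intros simp: field_simps power2_eq_square)
    have "((\<lambda>t. exp (- (1 / t)) / t ^ n) has_real_derivative
        flat (n + 2) t - real n * flat (n + 1) t) (at t)"
      by (rule DERIV_cong[OF DERIV_divide[OF exp pow]])
        (use 1 in \<open>simp_all add: flat_def field_simps power2_eq_square\<close>)
    then show ?thesis
      by (rule has_field_derivative_transform_within_open[where S = "{0<..}"])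
        (use 1 in \<open>auto simp: flat_def\<close>)
  next
    case 2
    have "((\<lambda>t. 0) has_real_derivative flat (n + 2) t - real n * flat (n + 1) t) (at t)"
      using 2 by (simp add: flat_def)
    then show ?thesis
      by (rule has_field_derivative_transform_within_open[where S = "{..<0}"])
        (use 2 in \<open>auto simp: flat_def\<close>)
  next
    case 3
    \<comment> \<open>The difference quotient of \<open>flat n\<close> at 0 is
      \<open>flat (Suc n)\<close>.\<close>
    have "((\<lambda>h. (flat n (0 + h) - flat n 0) / h) \<longlongrightarrow> 0) (at 0)"
      by (rule Lim_transform_eventually[OF flat_tendsto_0[of "Suc n"]])
        (auto simp: flat_def eventually_at_filter field_simps)
    then show ?thesis using 3 unfolding DERIV_def by (simp add: flat_def)
  qed
qed

lemma smooth_on_flat: "smooth_on (flat n) UNIV"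
proof (rule smooth_onI)
  fix k show "Ck_on k (flat n) UNIV"
  proof (induction k arbitrary: n)
    case 0
    show ?case using DERIV_isCont[OF flat_has_derivative] by (simp add: continuous_at_imp_continuous_on)
  next
    case (Suc k)
    show ?case
      by (rule Ck_on_SucI[OF flat_has_derivative[unfolded has_field_derivative_def]])
        (intro Ck_on_mult Ck_on_diff Ck_on_const Suc.IH open_UNIV)+
  qed
qed

text \<open>The given norm need not be smooth, so the bump is built from the sum of squares of the
  coordinates. It vanishes off a Euclidean ball in coordinates; \<open>K\<close> is the coordinate
  cube around that ball.\<close>

lemma (in finite_basis) smooth_bump:
  assumes "open S" "c \<in> S"
  obtains \<eta> :: "'a \<Rightarrow> real" and K where "smooth_on \<eta> UNIV" "\<eta> c = 1" "compact K" "K \<subseteq> S"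
    "\<And>x. x \<notin> K \<Longrightarrow> \<eta> x = 0"
proof -
  obtain e where e: "e > 0" "ball c e \<subseteq> S" using assms open_contains_ball by metis
  \<comment> \<open>A point of the cube with half-side \<open>r\<close> differs from
    \<open>c\<close> by at most \<open>r\<close> times the sum of the norms of the basis vectors;
    the extra 1 keeps this strictly below \<open>r * N = e\<close>.\<close>
  define N where "N = 1 + (\<Sum>b\<in>B. norm b)"
  have N: "N > 0" "N > (\<Sum>b\<in>B. norm b)" unfolding N_def by (simp_all add: add_pos_nonneg sum_nonneg)
  define r where "r = e / N"
  have r: "r > 0" using e N by (simp add: r_def)
  define K where "K = (+) c ` {x. \<forall>b\<in>B. \<bar>coord b x\<bar> \<le> r}"
  have K_iff: "x \<in> K \<longleftrightarrow> (\<forall>b\<in>B. \<bar>coord b (x - c)\<bar> \<le> r)" for x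
    unfolding K_def by (auto simp: image_iff intro!: exI[of _ "x - c"])
  define \<eta> where "\<eta> x = flat 0 (r\<^sup>2 - (\<Sum>b\<in>B. coord b (x - c) * coord b (x - c))) * inverse (flat 0 (r\<^sup>2))" for x
  have flat_r: "flat 0 (r\<^sup>2) > 0" using r by (simp add: flat_def)
  \<comment> \<open>The chain rule expands in a basis of the intermediate space, which is the real
    line when composing with \<open>flat 0\<close>.\<close>
  interpret real: finite_basis "{1 :: real}"
    by unfold_locales (auto simp: span_singleton)
  show thesis
  proof (rule that)
    have "smooth_on (\<lambda>x. flat 0 (r\<^sup>2 - (\<Sum>b\<in>B. coord b (x - c) * coord b (x - c)))) UNIV"
      by (rule real.smooth_on_compose[OF open_UNIV open_UNIV _ _ smooth_on_flat])
        (auto intro!: smooth_on_diff smooth_on_sum smooth_on_mult smooth_on_coord smooth_on_const smooth_on_ident)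
    then show "smooth_on \<eta> UNIV"
      unfolding \<eta>_def by (intro smooth_on_mult smooth_on_const open_UNIV)
    show "\<eta> c = 1" using flat_r by (simp add: \<eta>_def linear_0[OF coord_linear])
    show "compact K" unfolding K_def by (intro compact_translation compact_cube)
    show "K \<subseteq> S"
    proof
      fix x assume x: "x \<in> K"
      have "norm (x - c) = norm (\<Sum>b\<in>B. coord b (x - c) *\<^sub>R b)" by (simp add: coord_sum)
      also have "\<dots> \<le> (\<Sum>b\<in>B. norm (coord b (x - c) *\<^sub>R b))" by (rule norm_sum)
      also have "\<dots> \<le> (\<Sum>b\<in>B. r * norm b)"
        using x by (intro sum_mono) (auto simp: K_iff intro: mult_right_mono)
      also have "\<dots> = r * (\<Sum>b\<in>B. norm b)" by (simp add: sum_distrib_left)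
      also have "\<dots> < r * N" using r N by simp
      also have "\<dots> = e" using N by (simp add: r_def)
      finally show "x \<in> S" using e by (auto simp: dist_norm norm_minus_commute)
    qed
    fix x assume "x \<notin> K"
    then obtain b where b: "b \<in> B" "\<bar>coord b (x - c)\<bar> > r" by (auto simp: K_iff not_le)
    have "r\<^sup>2 \<le> (coord b (x - c))\<^sup>2"
      using b r by (metis abs_le_square_iff abs_of_pos less_imp_le)
    also have "\<dots> \<le> (\<Sum>b\<in>B. coord b (x - c) * coord b (x - c))"
      using member_le_sum[OF b(1), of "\<lambda>b. coord b (x - c) * coord b (x - c)"] finite_B
      by (simp add: power2_eq_square)
    finally show "\<eta> x = 0" by (simp add: \<eta>_def flat_def)
  qed
qed


section \<open>Hadamard's lemma\<close>

text \<open>Differentiation under the integral raises the exponent \<open>n\<close>, so the weight \<open>t\<^sup>n\<close> is needed for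
  the induction on the order of smoothness.\<close>

definition ray_integral :: "'a::real_normed_vector \<Rightarrow> nat \<Rightarrow> ('a \<Rightarrow> real) \<Rightarrow> 'a \<Rightarrow> real" where
  "ray_integral c n g x = integral {0..1} (\<lambda>t. t ^ n * g (c + t *\<^sub>R (x - c)))"

lemma ray_in_convex:
  fixes S :: "'a::real_normed_vector set"
  assumes "convex S" "c \<in> S" "x \<in> S" "t \<in> {0..1}"
  shows "c + t *\<^sub>R (x - c) \<in> S"
proof -
  have "c + t *\<^sub>R (x - c) = (1 - t) *\<^sub>R c + t *\<^sub>R x" by (simp add: algebra_simps)
  then show ?thesis using assms convexD_alt[of S c x t] by simp
qed

lemma ray_continuous:
  fixes g :: "'a::real_normed_vector \<Rightarrow> real"
  assumes "convex S" "c \<in> S" "continuous_on S g"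
  shows "continuous_on (S \<times> {0..1}) (\<lambda>(x, t). g (c + t *\<^sub>R (x - c)))"
proof -
  have "continuous_on (S \<times> {0..1}) (\<lambda>p. c + snd p *\<^sub>R (fst p - c))" by (intro continuous_intros)
  then show ?thesis
    unfolding case_prod_beta
    by (rule continuous_on_compose2[OF assms(3)]) (auto intro!: ray_in_convex[OF assms(1,2)])
qed

lemma ray_integrable:
  fixes g :: "'a::real_normed_vector \<Rightarrow> real"
  assumes "convex S" "c \<in> S" "continuous_on S g" "x \<in> S"
  shows "(\<lambda>t. t ^ n * g (c + t *\<^sub>R (x - c))) integrable_on {0..1::real}"
proof (rule integrable_continuous_real)
  have "continuous_on {0..1} (\<lambda>t. g (c + t *\<^sub>R (x - c)))"
    by (rule continuous_on_compose2[OF assms(3)])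
      (intro continuous_intros, use ray_in_convex[OF assms(1,2,4)] in blast)
  then show "continuous_on {0..1} (\<lambda>t. t ^ n * g (c + t *\<^sub>R (x - c)))"
    by (intro continuous_on_mult continuous_on_power continuous_on_id)
qed

context finite_basis
begin

text \<open>Compactness of the unit interval makes the derivative of \<open>g\<close> along the rays
  vary little with \<open>x\<close>, uniformly in \<open>t\<close>. The mean value inequality then
  bounds the linearisation error of the integrand uniformly in \<open>t\<close>, and the bound
  survives integration.\<close>

lemma ray_integral_has_derivative:
  assumes S: "open S" "convex S" "c \<in> S" and g: "Ck_on (Suc 0) g S" and x0: "x0 \<in> S"
  shows "(ray_integral c n g has_derivative
    (\<lambda>h. \<Sum>b\<in>B. coord b h *\<^sub>R ray_integral c (Suc n) (\<lambda>x. frechet_derivative g (at x) b) x0)) (at x0)"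
    (is "(?I has_derivative ?L) _")
  unfolding has_derivative_at_alt
proof (intro conjI allI impI)
  show "bounded_linear ?L"
    by (intro bounded_linear_sum bounded_linear_scaleR_const coord_bounded_linear)
  fix e :: real assume e: "e > 0"
  let ?D = "\<lambda>x. frechet_derivative g (at x)"
  let ?z = "\<lambda>t x. c + t *\<^sub>R (x - c)"
  have zS: "?z t x \<in> S" if "x \<in> S" "t \<in> {0..1}" for t x
    using ray_in_convex[OF S(2,3) that] .
  have dg: "(g has_derivative ?D x) (at x)" if "x \<in> S" for x
    using Ck_on_has_derivative[OF g that] .
  have linD: "linear (?D x)" if "x \<in> S" for x using dg[OF that] by (rule has_derivative_linear)
  have contD: "continuous_on S (\<lambda>x. ?D x b)" for b using Ck_on_derivative[OF g] by simp
  have contg: "continuous_on S g" using Ck_on_continuous[OF g] .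
  obtain C where C: "C > 0"
    "\<And>(f :: 'a \<Rightarrow> real) e x. linear f \<Longrightarrow> (\<And>b. b \<in> B \<Longrightarrow> norm (f b) \<le> e) \<Longrightarrow> norm (f x) \<le> e * C * norm x"
    using linear_small_on_basis[where 'b = real] by blast
  \<comment> \<open>Tube lemma: one neighbourhood of \<open>x0\<close> serves all
    \<open>t\<close>.\<close>
  have "\<exists>X. x0 \<in> X \<and> open X \<and> (\<forall>x\<in>X \<inter> S. \<forall>t\<in>{0..1}. \<bar>?D (?z t x) b - ?D (?z t x0) b\<bar> \<le> e / C)" for b
  proof -
    have "e / C > 0" using e C by simp
    then obtain X where "x0 \<in> X" "open X" "\<forall>x\<in>X \<inter> S. \<forall>t\<in>{0..1}.
        dist (case (x, t) of (x, t) \<Rightarrow> ?D (?z t x) b) (case (x0, t) of (x, t) \<Rightarrow> ?D (?z t x) b) \<le> e / C"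
      by (rule continuous_on_prod_compactE[OF ray_continuous[OF S(2,3) contD[of b]] compact_Icc x0])
    then show ?thesis by (intro exI[of _ X]) (simp add: dist_real_def)
  qed
  then obtain X where X: "\<And>b. x0 \<in> X b" "\<And>b. open (X b)"
    "\<And>b x t. x \<in> X b \<Longrightarrow> x \<in> S \<Longrightarrow> t \<in> {0..1} \<Longrightarrow> \<bar>?D (?z t x) b - ?D (?z t x0) b\<bar> \<le> e / C"
    by (metis IntI)
  have "open (S \<inter> (\<Inter>b\<in>B. X b))" "x0 \<in> S \<inter> (\<Inter>b\<in>B. X b)"
    using X S x0 finite_B by auto
  then obtain d where d: "d > 0" "ball x0 d \<subseteq> S \<inter> (\<Inter>b\<in>B. X b)"
    by (meson open_contains_ball)
  show "\<exists>d>0. \<forall>y. norm (y - x0) < d \<longrightarrow> norm (?I y - ?I x0 - ?L (y - x0)) \<le> e * norm (y - x0)"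
  proof (intro exI conjI allI impI)
    show "d > 0" by fact
    fix y assume y: "norm (y - x0) < d"
    then have y_ball: "y \<in> ball x0 d" by (simp add: dist_norm norm_minus_commute)
    then have yS: "y \<in> S" using d by blast
    let ?r = "\<lambda>t. g (?z t y) - g (?z t x0) - ?D (?z t x0) (t *\<^sub>R (y - x0))"
    have r: "\<bar>?r t\<bar> \<le> e * norm (y - x0)" if t: "t \<in> {0..1}" for t
    proof -
      \<comment> \<open>With the linear part at \<open>x0\<close> subtracted, the derivative is a
        difference of derivatives of \<open>g\<close> at two nearby points, hence of norm at most
        \<open>e\<close>.\<close>
      let ?\<phi> = "\<lambda>x. g (?z t x) - ?D (?z t x0) (t *\<^sub>R x)"
      have bl: "bounded_linear (\<lambda>h. ?D (?z t x0) (t *\<^sub>R h))"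
        by (intro bounded_linear_compose[OF has_derivative_bounded_linear[OF dg[OF zS[OF x0 t]]]]
            bounded_linear_scaleR_right)
      have "norm (?\<phi> y - ?\<phi> x0) \<le> e * norm (y - x0)"
      proof (rule differentiable_bound[OF convex_ball[of x0 d]])
        fix \<xi> assume \<xi>: "\<xi> \<in> ball x0 d"
        then have \<xi>S: "\<xi> \<in> S" and \<xi>X: "\<And>b. b \<in> B \<Longrightarrow> \<xi> \<in> X b" using d by auto
        let ?\<phi>' = "\<lambda>h. ?D (?z t \<xi>) (t *\<^sub>R h) - ?D (?z t x0) (t *\<^sub>R h)"
        have "(?z t has_derivative (\<lambda>h. t *\<^sub>R h)) (at \<xi>)"
          by (auto intro!: derivative_eq_intros)
        from has_derivative_compose[OF this dg[OF zS[OF \<xi>S t]]]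
        show "(?\<phi> has_derivative ?\<phi>') (at \<xi> within ball x0 d)"
          by (rule has_derivative_at_withinI[OF has_derivative_diff[OF _ bounded_linear_imp_has_derivative[OF bl]]])
        show "onorm ?\<phi>' \<le> e"
        proof (rule onorm_bound)
          fix h
          have "linear (\<lambda>h. ?D (?z t \<xi>) h - ?D (?z t x0) h)"
            by (intro linear_compose_sub linD zS t \<xi>S x0)
          then have "norm (?\<phi>' h) \<le> e / C * C * norm (t *\<^sub>R h)"
            by (rule C(2)) (use X(3) \<xi>S \<xi>X t in auto)
          also have "\<dots> = e * (\<bar>t\<bar> * norm h)" using C by simp
          also have "\<dots> \<le> e * norm h"
            using t e by (intro mult_left_mono) (auto intro: mult_left_le_one_le)
          finally show "norm (?\<phi>' h) \<le> e * norm h" .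
        qed (use e in simp)
      qed (use y_ball d in auto)
      moreover have "?\<phi> y - ?\<phi> x0 = ?r t"
        using linear_diff[OF linD[OF zS[OF x0 t]], of "t *\<^sub>R y" "t *\<^sub>R x0"]
        by (simp add: scaleR_diff_right)
      ultimately show ?thesis by simp
    qed
    have I: "((\<lambda>t. t ^ n * g (?z t x)) has_integral ?I x) {0..1}" if "x \<in> S" for x
      unfolding ray_integral_def by (intro integrable_integral ray_integrable[OF S(2,3) contg that])
    have "((\<lambda>t. \<Sum>b\<in>B. coord b (y - x0) *\<^sub>R (t ^ Suc n * ?D (?z t x0) b)) has_integral ?L (y - x0)) {0..1}"
      unfolding ray_integral_def
      by (intro has_integral_sum has_integral_cmul integrable_integral finite_B
          ray_integrable[OF S(2,3) contD x0])
    then have L: "((\<lambda>t. t ^ n * ?D (?z t x0) (t *\<^sub>R (y - x0))) has_integral ?L (y - x0)) {0..1}"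
    proof (rule has_integral_eq[rotated])
      fix t :: real assume t: "t \<in> {0..1}"
      have "?D (?z t x0) (t *\<^sub>R (y - x0)) = t * (\<Sum>b\<in>B. coord b (y - x0) *\<^sub>R ?D (?z t x0) b)"
        using linear_scale[OF linD[OF zS[OF x0 t]]] linear_expand[OF linD[OF zS[OF x0 t]], of "y - x0"] by simp
      then show "(\<Sum>b\<in>B. coord b (y - x0) *\<^sub>R (t ^ Suc n * ?D (?z t x0) b)) = t ^ n * ?D (?z t x0) (t *\<^sub>R (y - x0))"
        by (simp add: sum_distrib_left mult_ac)
    qed
    have "((\<lambda>t. t ^ n * ?r t) has_integral (?I y - ?I x0 - ?L (y - x0))) (cbox 0 1)"
      using has_integral_diff[OF has_integral_diff[OF I[OF yS] I[OF x0]] L] by (simp add: algebra_simps)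
    then have "norm (?I y - ?I x0 - ?L (y - x0)) \<le> e * norm (y - x0) * measure lborel (cbox 0 (1::real))"
    proof (rule has_integral_bound[rotated])
      fix t :: real assume "t \<in> cbox 0 1"
      then have t: "t \<in> {0..1}" by simp
      have "norm (t ^ n * ?r t) = t ^ n * \<bar>?r t\<bar>" using t by (simp add: abs_mult)
      also have "\<dots> \<le> 1 * (e * norm (y - x0))" using t r[OF t] by (intro mult_mono power_le_one) auto
      finally show "norm (t ^ n * ?r t) \<le> e * norm (y - x0)" by simp
    qed (use e in simp)
    then show "norm (?I y - ?I x0 - ?L (y - x0)) \<le> e * norm (y - x0)" by simp
  qed
qed

lemma Ck_on_ray_integral:
  fixes g :: "'a \<Rightarrow> real"
  assumes S: "open S" "convex S" "c \<in> S" and g: "Ck_on k g S"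
  shows "Ck_on k (ray_integral c n g) S"
  using g
proof (induction k arbitrary: n g)
  case 0
  have "continuous_on (S \<times> cbox 0 1) (\<lambda>(x, t). t ^ n * g (c + t *\<^sub>R (x - c)))"
    using ray_continuous[OF S(2,3), of g] 0 unfolding case_prod_beta
    by (auto intro!: continuous_intros)
  from integral_continuous_on_param[OF this] show ?case
    by (simp add: ray_integral_def[abs_def])
next
  case (Suc k)
  have g1: "Ck_on (Suc 0) g S" using Suc.prems Ck_on_continuous by fastforce
  show ?case
    by (rule Ck_on_SucI[OF ray_integral_has_derivative[OF S g1] _ S(1)])
      (assumption, intro Ck_on_sum Ck_on_scaleR Ck_on_const S(1) Suc.IH Ck_on_derivative[OF Suc.prems])
qed

text \<open>The fundamental theorem of calculus along the segment from \<open>c\<close> to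
  \<open>x\<close> gives \<open>g x - g c\<close> as an integral of the derivative in direction
  \<open>x - c\<close>, which is then expanded in the basis. \<open>G b\<close> is the mean over the
  segment of the derivative in direction \<open>b\<close>.\<close>

lemma Hadamard:
  fixes g :: "'a \<Rightarrow> real"
  assumes S: "open S" "convex S" "c \<in> S" and g: "smooth_on g S"
  obtains G where "\<And>b. smooth_on (G b) S" "\<And>b. G b c = frechet_derivative g (at c) b"
    "\<And>x. x \<in> S \<Longrightarrow> g x = g c + (\<Sum>b\<in>B. coord b (x - c) * G b x)"
proof
  let ?D = "\<lambda>x. frechet_derivative g (at x)"
  define G where "G b = ray_integral c 0 (\<lambda>x. ?D x b)" for b
  show "smooth_on (G b) S" for b
    unfolding G_def by (rule smooth_onI, rule Ck_on_ray_integral[OF S], rule Ck_on_derivative, rule smooth_onD[OF g])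
  show "G b c = ?D c b" for b by (simp add: G_def ray_integral_def)
  fix x assume x: "x \<in> S"
  let ?z = "\<lambda>t. c + t *\<^sub>R (x - c)"
  have "((\<lambda>t. ?D (?z t) (x - c)) has_integral g (?z 1) - g (?z 0)) {0..1}"
  proof (rule fundamental_theorem_of_calculus)
    fix t :: real assume t: "t \<in> {0..1}"
    have "(?z has_derivative (\<lambda>h. h *\<^sub>R (x - c))) (at t within {0..1})"
      by (auto intro!: derivative_eq_intros)
    from has_derivative_in_compose[OF this has_derivative_at_withinI[OF smooth_on_has_derivative[OF g ray_in_convex[OF S(2,3) x t]]]]
    show "((\<lambda>t. g (?z t)) has_vector_derivative ?D (?z t) (x - c)) (at t within {0..1})"
      unfolding has_vector_derivative_def
      by (rule has_derivative_eq_rhs)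
        (use linear_scale[OF has_derivative_linear[OF smooth_on_has_derivative[OF g ray_in_convex[OF S(2,3) x t]]]] in auto)
  qed simp
  then have 1: "((\<lambda>t. ?D (?z t) (x - c)) has_integral g x - g c) {0..1}" by simp
  have "((\<lambda>t. \<Sum>b\<in>B. coord b (x - c) *\<^sub>R (t ^ 0 * ?D (?z t) b)) has_integral (\<Sum>b\<in>B. coord b (x - c) *\<^sub>R G b x)) {0..1}"
    unfolding G_def ray_integral_def
    by (intro has_integral_sum has_integral_cmul integrable_integral finite_B
        ray_integrable[OF S(2,3) _ x] smooth_on_continuous smooth_on_derivative g)
  then have "((\<lambda>t. ?D (?z t) (x - c)) has_integral (\<Sum>b\<in>B. coord b (x - c) *\<^sub>R G b x)) {0..1}"
  proof (rule has_integral_eq[rotated])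
    fix t :: real assume t: "t \<in> {0..1}"
    show "(\<Sum>b\<in>B. coord b (x - c) *\<^sub>R (t ^ 0 * ?D (?z t) b)) = ?D (?z t) (x - c)"
      using has_derivative_expand[OF smooth_on_has_derivative[OF g ray_in_convex[OF S(2,3) x t]], of "x - c"]
      by simp
  qed
  from has_integral_unique[OF this 1] show "g x = g c + (\<Sum>b\<in>B. coord b (x - c) * G b x)" by simp
qed

end


section \<open>Local right inverses\<close>

context finite_basis
begin

text \<open>Because the derivative at \<open>c\<close> is the identity,
  \<open>\<phi> x = f x - x\<close> is a contraction near \<open>c\<close>, and
  \<open>f x = y\<close> becomes the fixed point equation \<open>x = y - \<phi> x\<close>.\<close>

lemma local_inverse:
  fixes f :: "'a \<Rightarrow> 'a"
  assumes S: "open S" "c \<in> S" and f: "smooth_on f S"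
    and id: "\<And>v. frechet_derivative f (at c) v = v"
  obtains V \<sigma> where "open V" "f c \<in> V" "\<sigma> ` V \<subseteq> S" "smooth_on \<sigma> V" "\<And>y. y \<in> V \<Longrightarrow> f (\<sigma> y) = y"
proof -
  let ?D = "\<lambda>x. frechet_derivative f (at x)"
  have df: "(f has_derivative ?D x) (at x)" if "x \<in> S" for x
    using smooth_on_has_derivative[OF f that] .
  have linD: "linear (?D x)" if "x \<in> S" for x using df[OF that] by (rule has_derivative_linear)
  obtain C where C: "C > 0"
    "\<And>(f :: 'a \<Rightarrow> 'a) e x. linear f \<Longrightarrow> (\<And>b. b \<in> B \<Longrightarrow> norm (f b) \<le> e) \<Longrightarrow> norm (f x) \<le> e * C * norm x"
    using linear_small_on_basis[where 'b = 'a] by blast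
  \<comment> \<open>Derivatives within \<open>e\<close> of the identity on the basis differ from it
    by at most \<open>e * C = 1 / 2\<close> in operator norm.\<close>
  define e where "e = 1 / (2 * C)"
  have e: "e > 0" using C by (simp add: e_def)
  have "eventually (\<lambda>x. x \<in> S \<and> (\<forall>b\<in>B. dist (?D x b) (?D c b) < e)) (nhds c)"
  proof (intro eventually_conj eventually_ball_finite finite_B ballI)
    show "eventually (\<lambda>x. x \<in> S) (nhds c)" using S by (rule eventually_nhds_in_open)
    fix b
    have "isCont (\<lambda>x. ?D x b) c"
      using smooth_on_continuous[OF smooth_on_derivative[OF f]] S continuous_on_eq_continuous_at by blast
    then have "((\<lambda>x. ?D x b) \<longlongrightarrow> ?D c b) (nhds c)"
      unfolding isCont_def tendsto_at_iff_tendsto_nhds[of "\<lambda>x. ?D x b" c] .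
    then show "eventually (\<lambda>x. dist (?D x b) (?D c b) < e) (nhds c)" using e by (rule tendstoD)
  qed
  then obtain d where d: "d > 0"
    "\<And>x. x \<in> ball c d \<Longrightarrow> x \<in> S \<and> (\<forall>b\<in>B. dist (?D x b) (?D c b) < e)"
    unfolding eventually_nhds_metric by (auto simp: dist_commute)
  let ?W = "ball c d"
  have WS: "?W \<subseteq> S" using d by blast
  have near_id: "norm (?D x u - u) \<le> 1 / 2 * norm u" if x: "x \<in> ?W" for x u
  proof -
    have "linear (\<lambda>u. ?D x u - u)" using linD WS x by (intro linear_compose_sub linear_ident) auto
    moreover have "norm (?D x b - b) \<le> e" if "b \<in> B" for b
      using d(2)[OF x] that id by (auto simp: dist_norm)
    ultimately have "norm (?D x u - u) \<le> e * C * norm u" by (rule C(2))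
    then show ?thesis using C by (simp add: e_def)
  qed
  define \<phi> where "\<phi> x = f x - x" for x
  have lip: "norm (\<phi> x - \<phi> y) \<le> 1 / 2 * norm (x - y)" if "x \<in> ?W" "y \<in> ?W" for x y
  proof (rule differentiable_bound[OF convex_ball[of c d] _ _ that])
    fix z assume z: "z \<in> ?W"
    show "(\<phi> has_derivative (\<lambda>u. ?D z u - u)) (at z within ?W)"
      unfolding \<phi>_def[abs_def] using df z WS
      by (intro has_derivative_at_withinI[OF has_derivative_diff[OF _ has_derivative_ident]]) auto
    show "onorm (\<lambda>u. ?D z u - u) \<le> 1 / 2" by (rule onorm_bound) (use near_id[OF z] in auto)
  qed
  have lower: "norm (x - y) \<le> 2 * norm (f x - f y)" if "x \<in> ?W" "y \<in> ?W" for x y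
    using lip[OF that] norm_triangle_ineq4[of "f x - f y" "\<phi> x - \<phi> y"] by (simp add: \<phi>_def)
  have Dlower: "norm u \<le> 2 * norm (?D x u)" if "x \<in> ?W" for x u
    using near_id[OF that, of u] norm_triangle_ineq4[of "?D x u" "?D x u - u"] by simp
  \<comment> \<open>Halving \<open>d\<close> puts the closed ball inside \<open>?W\<close>. For
    \<open>y\<close> within \<open>r / 2\<close> of \<open>f c\<close>, the fixed point map
    displaces \<open>c\<close> by less than \<open>r / 2\<close> and halves distances, so it
    preserves the closed ball of radius \<open>r\<close>.\<close>
  define r where "r = d / 2"
  have r: "r > 0" "cball c r \<subseteq> ?W" using d by (auto simp: r_def)
  let ?V = "ball (f c) (r / 2)"
  have "\<exists>x\<in>cball c r. f x = y" if y: "y \<in> ?V" for y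
  proof -
    have "\<exists>!x\<in>cball c r. y - \<phi> x = x"
    proof (rule Banach_fix)
      show "complete (cball c r)"
        using complete_UNIV_finite_dim closed_cball complete_Int_closed by (metis inf_top_left)
      show "cball c r \<noteq> {}" using r by simp
      show "(\<lambda>x. y - \<phi> x) ` cball c r \<subseteq> cball c r"
      proof
        fix z assume "z \<in> (\<lambda>x. y - \<phi> x) ` cball c r"
        then obtain x where x: "x \<in> cball c r" "z = y - \<phi> x" by blast
        have "norm (z - c) = norm ((y - f c) + (\<phi> c - \<phi> x))" by (simp add: x \<phi>_def algebra_simps)
        also have "\<dots> \<le> norm (y - f c) + norm (\<phi> c - \<phi> x)" by (rule norm_triangle_ineq)
        also have "\<dots> \<le> r / 2 + 1 / 2 * norm (c - x)"
          using y x r d lip[of c x] by (intro add_mono) (auto simp: dist_norm norm_minus_commute)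
        also have "\<dots> \<le> r" using x by (simp add: dist_norm)
        finally show "z \<in> cball c r" by (simp add: dist_norm norm_minus_commute)
      qed
      show "dist (y - \<phi> x) (y - \<phi> x') \<le> 1 / 2 * dist x x'" if "x \<in> cball c r" "x' \<in> cball c r" for x x'
        using lip[of x x'] r(2)[THEN subsetD, OF that(1)] r(2)[THEN subsetD, OF that(2)]
        by (simp add: dist_norm norm_minus_commute)
    qed simp_all
    then obtain x where "x \<in> cball c r" "y - \<phi> x = x" by blast
    then show ?thesis by (intro bexI[of _ x]) (simp_all add: \<phi>_def diff_eq_eq)
  qed
  then obtain \<sigma> where \<sigma>: "\<And>y. y \<in> ?V \<Longrightarrow> \<sigma> y \<in> cball c r" "\<And>y. y \<in> ?V \<Longrightarrow> f (\<sigma> y) = y" by metis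
  have \<sigma>W: "\<sigma> y \<in> ?W" if "y \<in> ?V" for y using \<sigma>(1)[OF that] r by blast
  \<comment> \<open>By \<open>lower\<close> the inverse is 2-Lipschitz; its continuity comes before
    its differentiability.\<close>
  have cont_on: "continuous_on ?V \<sigma>"
    by (rule lipschitz_on_continuous_on[of 2], rule lipschitz_onI)
      (use lower[OF \<sigma>W \<sigma>W] \<sigma>(2) in \<open>auto simp: dist_norm\<close>)
  have cont: "isCont \<sigma> y" if "y \<in> ?V" for y
    using cont_on that continuous_on_eq_continuous_at by blast
  define J where "J x = inv_into UNIV (?D x)" for x
  have J: "bounded_linear (J x)" "J x \<circ> ?D x = id" if "x \<in> ?W" for x
  proof -
    have *: "linear (?D x)" using linD WS that by blast
    show "bounded_linear (J x)"
      unfolding J_def by (rule linear_bounded_linear[OF bij_of_lower_bound(2)[OF * Dlower[OF that]]])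
    show "J x \<circ> ?D x = id"
      unfolding J_def by (rule inv_o_cancel[OF bij_is_inj[OF bij_of_lower_bound(1)[OF * Dlower[OF that]]]])
  qed
  have d\<sigma>: "(\<sigma> has_derivative J (\<sigma> y)) (at y)" if "y \<in> ?V" for y
  proof (rule has_derivative_inverse_basic[OF _ _ _ cont[OF that] open_ball that \<sigma>(2)])
    show "(f has_derivative ?D (\<sigma> y)) (at (\<sigma> y))" using df \<sigma>W[OF that] WS by blast
  qed (rule J[OF \<sigma>W[OF that]])+
  have Ck_J: "Ck_on k (\<lambda>x. J x v) ?W" for k v
    unfolding J_def
    by (rule Ck_on_linear_inverse[OF open_ball _ Dlower])
      (use linD WS smooth_on_subset[OF smooth_on_derivative[OF f] WS] in \<open>auto intro: smooth_onD\<close>)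
  \<comment> \<open>Quantifying over \<open>h\<close> makes the derivative of \<open>h \<circ> \<sigma>\<close> again of the form \<open>h' \<circ> \<sigma>\<close>.\<close>
  have "Ck_on k (\<lambda>y. h (\<sigma> y)) ?V" if "Ck_on k h ?W" for k and h :: "'a \<Rightarrow> 'a"
    using that
  proof (induction k arbitrary: h)
    case 0
    then show ?case
      using continuous_on_compose2[of ?W h ?V \<sigma>] cont_on \<sigma>W by (simp add: image_subset_iff)
  next
    case (Suc k)
    have dh: "(h has_derivative frechet_derivative h (at x)) (at x)" if "x \<in> ?W" for x
      using Ck_on_has_derivative[OF Suc.prems that] .
    show ?case
    proof (rule Ck_on_SucI[OF _ _ open_ball])
      fix y assume y: "y \<in> ?V"
      show "((\<lambda>y. h (\<sigma> y)) has_derivative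
          (\<lambda>v. \<Sum>b\<in>B. coord b (J (\<sigma> y) v) *\<^sub>R frechet_derivative h (at (\<sigma> y)) b)) (at y)"
        by (rule has_derivative_eq_rhs[OF has_derivative_compose[OF d\<sigma>[OF y] dh[OF \<sigma>W[OF y]]]])
          (rule ext, rule has_derivative_expand[OF dh[OF \<sigma>W[OF y]]])
    next
      fix v
      have "Ck_on k (\<lambda>x. \<Sum>b\<in>B. coord b (J x v) *\<^sub>R frechet_derivative h (at x) b) ?W"
        by (intro Ck_on_sum Ck_on_scaleR Ck_on_coord open_ball Ck_J Ck_on_derivative[OF Suc.prems])
      from Suc.IH[OF this]
      show "Ck_on k (\<lambda>y. \<Sum>b\<in>B. coord b (J (\<sigma> y) v) *\<^sub>R frechet_derivative h (at (\<sigma> y)) b) ?V" .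
    qed
  qed
  from this[OF smooth_onD[OF smooth_on_ident]] have "smooth_on \<sigma> ?V" by (intro smooth_onI)
  moreover have "\<sigma> ` ?V \<subseteq> S" using \<sigma>W WS by blast
  ultimately show thesis using that[of ?V \<sigma>] r \<sigma>(2) by simp
qed

end

text \<open>For a linear right inverse \<open>R\<close> of the derivative, the map sending
  \<open>h\<close> to \<open>f (c + R h)\<close> goes from the target space to itself with identity
  derivative at 0. A local inverse of it, followed by the affine map \<open>c + R h\<close>, is the
  section sought.\<close>

lemma local_right_inverse:
  fixes f :: "'e::real_normed_vector \<Rightarrow> 'f::real_normed_vector"
  assumes "finite_basis (BE :: 'e set)" "finite_basis (BF :: 'f set)"
    and S: "open S" "c \<in> S" and f: "smooth_on f S"
    and surj: "surj (frechet_derivative f (at c))"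
  obtains V \<sigma> where "open V" "f c \<in> V" "\<sigma> ` V \<subseteq> S" "smooth_on \<sigma> V" "\<And>y. y \<in> V \<Longrightarrow> f (\<sigma> y) = y"
proof -
  interpret E: finite_basis BE by fact
  interpret F: finite_basis BF by fact
  let ?D = "frechet_derivative f (at c)"
  obtain u where u: "\<And>b. ?D (u b) = b" using surj by (metis surjD)
  define R where "R h = (\<Sum>b\<in>BF. F.coord b h *\<^sub>R u b)" for h
  have R: "bounded_linear R"
    unfolding R_def by (intro bounded_linear_sum bounded_linear_scaleR_const F.coord_bounded_linear)
  have df: "(f has_derivative ?D) (at c)" using smooth_on_has_derivative[OF f S(2)] .
  have DR: "?D (R h) = h" for h
    unfolding R_def using has_derivative_linear[OF df] by (simp add: linear_sum linear_scale u F.coord_sum)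
  define S' where "S' = {h. c + R h \<in> S}"
  have "open S'"
    unfolding S'_def vimage_def[symmetric]
    by (intro open_vimage S continuous_intros bounded_linear.continuous_on[OF R])
  have 0: "0 \<in> S'" using S by (simp add: S'_def linear_0[OF bounded_linear.linear[OF R]])
  have sR: "smooth_on (\<lambda>h. c + R h) T" for T
    by (rule smooth_on_subset[of _ UNIV], intro smooth_on_add smooth_on_const smooth_on_bounded_linear[OF R] open_UNIV) simp
  have sf: "smooth_on (\<lambda>h. f (c + R h)) S'"
    by (rule E.smooth_on_compose[OF \<open>open S'\<close> S(1) _ sR f]) (auto simp: S'_def)
  have R0: "R 0 = 0" by (rule linear_0[OF bounded_linear.linear[OF R]])
  have "((\<lambda>h. c + R h) has_derivative R) (at 0)"
    using bounded_linear_imp_has_derivative[OF R] by (auto intro!: derivative_eq_intros)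
  then have "((\<lambda>h. f (c + R h)) has_derivative (\<lambda>h. ?D (R h))) (at 0)"
    by (rule has_derivative_compose) (simp add: R0 df)
  then have "frechet_derivative (\<lambda>h. f (c + R h)) (at 0) v = v" for v
    using frechet_derivative_at DR by metis
  from F.local_inverse[OF \<open>open S'\<close> 0 sf this] obtain V \<sigma> where V: "open V" "f (c + R 0) \<in> V" "\<sigma> ` V \<subseteq> S'"
    "smooth_on \<sigma> V" "\<And>y. y \<in> V \<Longrightarrow> f (c + R (\<sigma> y)) = y" by metis
  show thesis
  proof (rule that[OF V(1)])
    show "f c \<in> V" using V(2) by (simp add: R0)
    show "(\<lambda>y. c + R (\<sigma> y)) ` V \<subseteq> S" using V(3) by (auto simp: S'_def)
    show "smooth_on (\<lambda>y. c + R (\<sigma> y)) V"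
      by (intro smooth_on_add smooth_on_const smooth_on_linear_compose[OF R] V)
    show "f (c + R (\<sigma> y)) = y" if "y \<in> V" for y using V(5)[OF that] .
  qed
qed


section \<open>Charts and smooth functions\<close>

lemma manifold_finite_basis:
  fixes M :: "('p, 'e::real_normed_vector) mfd"
  assumes "smooth_manifold M"
  obtains B :: "'e set" where "finite_basis B"
  using assms finite_basis_exists unfolding smooth_manifold_def by metis

lemma chart_exists:
  assumes "smooth_manifold M" "x \<in> pts M"
  obtains U \<phi> where "(U, \<phi>) \<in> atlas M" "x \<in> U"
  using assms unfolding smooth_manifold_def by fastforce

locale manifold_chart =
  fixes M :: "('p, 'e::real_normed_vector) mfd" and U :: "'p set" and \<phi> :: "'p \<Rightarrow> 'e"
  assumes manifold: "smooth_manifold M" and chart: "(U, \<phi>) \<in> atlas M"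
begin

abbreviation "\<psi> \<equiv> inv_into U \<phi>"

lemma is_chart: "is_chart (mtop M) (U, \<phi>)"
  using manifold chart unfolding smooth_manifold_def by blast

lemma open_domain: "openin (mtop M) U" and open_range: "open (\<phi> ` U)"
  and homeo: "homeomorphic_map (subtopology (mtop M) U) (top_of_set (\<phi> ` U)) \<phi>"
  using is_chart by (simp_all add: is_chart_def)

lemma domain_subset: "U \<subseteq> pts M"
  using open_domain by (rule openin_subset)

lemma inj: "inj_on \<phi> U"
  using homeomorphic_imp_injective_map[OF homeo] domain_subset by (simp add: inf_absorb2)

lemma inverse_in [simp]: "y \<in> \<phi> ` U \<Longrightarrow> \<psi> y \<in> U"
  by (rule inv_into_into)

lemma left_inverse [simp]: "x \<in> U \<Longrightarrow> \<psi> (\<phi> x) = x"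
  using inj by simp

lemma right_inverse [simp]: "y \<in> \<phi> ` U \<Longrightarrow> \<phi> (\<psi> y) = y"
  by (rule f_inv_into_f)

lemma open_image:
  assumes "openin (mtop M) W" "W \<subseteq> U"
  shows "open (\<phi> ` W)"
proof -
  have "openin (subtopology (mtop M) U) W"
    using assms by (simp add: openin_open_subtopology open_domain)
  then have "openin (top_of_set (\<phi> ` U)) (\<phi> ` W)"
    using homeomorphic_imp_open_map[OF homeo] by (simp add: open_map_def)
  then show ?thesis using open_range openin_open_trans by blast
qed

lemma open_preimage:
  assumes "open S" shows "openin (mtop M) {x \<in> U. \<phi> x \<in> S}"
proof -
  have "continuous_map (subtopology (mtop M) U) euclidean \<phi>"
    using homeomorphic_imp_continuous_map[OF homeo] continuous_map_in_subtopology by blast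
  then have "openin (subtopology (mtop M) U) {x \<in> topspace (subtopology (mtop M) U). \<phi> x \<in> S}"
    by (rule openin_continuous_map_preimage) (simp add: assms)
  moreover have "topspace (subtopology (mtop M) U) = U" using domain_subset by auto
  ultimately show ?thesis using open_domain openin_open_subtopology by metis
qed

lemma inverse_continuous: "continuous_map (top_of_set (\<phi> ` U)) (mtop M) \<psi>"
proof -
  obtain g where g: "homeomorphic_maps (subtopology (mtop M) U) (top_of_set (\<phi> ` U)) \<phi> g"
    using homeo homeomorphic_map_maps by blast
  have "continuous_map (top_of_set (\<phi> ` U)) (mtop M) g"
    using g unfolding homeomorphic_maps_def by (meson continuous_map_in_subtopology)
  moreover have "g y = \<psi> y" if "y \<in> topspace (top_of_set (\<phi> ` U))" for y
    using that g domain_subset unfolding homeomorphic_maps_def by auto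
  ultimately show ?thesis by (rule continuous_map_eq)
qed

lemma transition_smooth:
  assumes "(V, \<xi>) \<in> atlas M"
  shows "smooth_on (\<xi> \<circ> \<psi>) (\<phi> ` (U \<inter> V))"
  using manifold chart assms unfolding smooth_manifold_def smoothly_compatible_def by fastforce

end

lemma manifold_chartI: "smooth_manifold M \<Longrightarrow> (U, \<phi>) \<in> atlas M \<Longrightarrow> manifold_chart M U \<phi>"
  by (rule manifold_chart.intro)

text \<open>Chart domains are open and cover \<open>M\<close>, so smoothness in charts already
  implies the continuity demanded by \<open>smooth_map\<close>.\<close>

lemma smooth_functions_iff:
  assumes M: "smooth_manifold M"
  shows "g \<in> smooth_functions M \<longleftrightarrow> (\<forall>(U, \<phi>)\<in>atlas M. smooth_on (g \<circ> inv_into U \<phi>) (\<phi> ` U))"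
    (is "_ \<longleftrightarrow> ?R")
proof -
  have "continuous_map (mtop M) euclideanreal g" if R: ?R
    unfolding continuous_map
  proof (intro conjI allI impI)
    fix S :: "real set" assume "openin euclideanreal S"
    then have S: "open S" by simp
    have "openin (mtop M) {x \<in> U. g x \<in> S}" if c: "(U, \<phi>) \<in> atlas M" for U \<phi>
    proof -
      interpret manifold_chart M U \<phi> using M c by (rule manifold_chartI)
      have "continuous_on (\<phi> ` U) (g \<circ> \<psi>)" using R c smooth_on_continuous by blast
      then have "open ((g \<circ> \<psi>) -` S \<inter> \<phi> ` U)" 
        using S continuous_on_open_vimage[OF open_range] by blast
      from open_preimage[OF this] have "openin (mtop M) {x \<in> U. \<phi> x \<in> (g \<circ> \<psi>) -` S \<inter> \<phi> ` U}" .
      moreover have "{x \<in> U. \<phi> x \<in> (g \<circ> \<psi>) -` S \<inter> \<phi> ` U} = {x \<in> U. g x \<in> S}" by (auto simp: inj_on_eq_iff[OF inj])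
      ultimately show ?thesis by argo
    qed
    then have "openin (mtop M) (\<Union>(U, \<phi>)\<in>atlas M. {x \<in> U. g x \<in> S})" by (intro openin_Union) auto
    moreover have "pts M = (\<Union>c\<in>atlas M. fst c)" using M unfolding smooth_manifold_def by blast
    then have "{x \<in> pts M. g x \<in> S} = (\<Union>(U, \<phi>)\<in>atlas M. {x \<in> U. g x \<in> S})" by fastforce
    ultimately show "openin (mtop M) {x \<in> topspace (mtop M). g x \<in> S}" by argo
  qed simp
  then show ?thesis
    by (auto simp: smooth_functions_def smooth_map_def vector_space_mfd_def)
qed

lemma smooth_functions_add:
  assumes M: "smooth_manifold M" and "g \<in> smooth_functions M" "h \<in> smooth_functions M"
  shows "(\<lambda>x. g x + h x) \<in> smooth_functions M"
  using assms(2,3) unfolding smooth_functions_iff[OF M]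
  by (auto simp: comp_def intro!: smooth_on_add manifold_chart.open_range[OF manifold_chartI[OF M]])

lemma smooth_functions_mult:
  assumes M: "smooth_manifold M" and "g \<in> smooth_functions M" "h \<in> smooth_functions M"
  shows "(\<lambda>x. g x * h x) \<in> smooth_functions M"
  using assms(2,3) unfolding smooth_functions_iff[OF M]
  by (auto simp: comp_def intro!: smooth_on_mult manifold_chart.open_range[OF manifold_chartI[OF M]])

lemma smooth_functions_const:
  assumes M: "smooth_manifold M" shows "(\<lambda>x. c) \<in> smooth_functions M"
  unfolding smooth_functions_iff[OF M] by (auto simp: comp_def intro!: smooth_on_const)

lemma smooth_functions_sum:
  assumes M: "smooth_manifold M" and "\<And>i. i \<in> I \<Longrightarrow> g i \<in> smooth_functions M"
  shows "(\<lambda>x. \<Sum>i\<in>I. g i x) \<in> smooth_functions M"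
  using assms(2)
  by (induction I rule: infinite_finite_induct)
    (auto intro: smooth_functions_add[OF M] smooth_functions_const[OF M])

context manifold_chart
begin

text \<open>The preimage of \<open>K\<close> in \<open>M\<close> is compact, hence closed in a
  Hausdorff space. Its complement, where the extension vanishes, and the part of the chart over
  \<open>S\<close> therefore form an open cover of \<open>M\<close>.\<close>

lemma smooth_extension:
  assumes S: "open S" "S \<subseteq> \<phi> ` U" and K: "compact K" "K \<subseteq> S"
    and h: "smooth_on h S" "\<And>y. y \<in> S \<Longrightarrow> y \<notin> K \<Longrightarrow> h y = 0"
  shows "(\<lambda>x. if x \<in> U \<and> \<phi> x \<in> S then h (\<phi> x) else 0) \<in> smooth_functions M"
    (is "?g \<in> _")
  unfolding smooth_functions_iff[OF manifold]
proof clarify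
  fix V \<xi> assume c: "(V, \<xi>) \<in> atlas M"
  interpret V: manifold_chart M V \<xi> using manifold c by (rule manifold_chartI)
  obtain B :: "'e set" where "finite_basis B" using manifold_finite_basis[OF manifold] .
  then interpret finite_basis B .
  let ?N = "{x \<in> U. \<phi> x \<in> S}"
  let ?C = "\<psi> ` K"
  have "compactin (top_of_set (\<phi> ` U)) K" using K S by (simp add: compactin_subtopology)
  then have "compactin (mtop M) ?C" using inverse_continuous by (rule image_compactin)
  then have C: "closedin (mtop M) ?C"
    using manifold unfolding smooth_manifold_def by (meson compactin_imp_closedin)
  show "smooth_on (?g \<circ> V.\<psi>) (\<xi> ` V)"
  proof (rule smooth_on_locally)
    fix y assume "y \<in> \<xi> ` V"
    then obtain x where x: "x \<in> V" "y = \<xi> x" by blast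
    show "\<exists>T. open T \<and> y \<in> T \<and> smooth_on (?g \<circ> V.\<psi>) T"
    proof (cases "x \<in> ?N")
      case True
      let ?T = "\<xi> ` (V \<inter> ?N)"
      have T: "open ?T"
        by (intro V.open_image openin_Int V.open_domain open_preimage S) auto
      have t: "smooth_on (\<phi> \<circ> V.\<psi>) ?T"
        using V.transition_smooth[OF chart] by (rule smooth_on_subset) auto
      have "smooth_on (\<lambda>y. h ((\<phi> \<circ> V.\<psi>) y)) ?T"
        by (rule smooth_on_compose[OF T S(1) _ t h(1)]) auto
      then have "smooth_on (?g \<circ> V.\<psi>) ?T"
        by (rule smooth_on_cong[OF T]) auto
      then show ?thesis using T True x by blast
    next
      case False
      let ?T = "\<xi> ` (V - ?C)"
      have T: "open ?T"
        by (intro V.open_image openin_diff V.open_domain C) auto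
      have g0: "?g z = 0" if "z \<in> V - ?C" for z
      proof (cases "z \<in> ?N")
        case True
        then have "\<phi> z \<notin> K" using that by (metis (lifting) DiffD2 image_eqI left_inverse mem_Collect_eq)
        then show ?thesis using h(2) True by simp
      qed auto
      have "smooth_on (?g \<circ> V.\<psi>) ?T"
      proof (rule smooth_on_cong[OF T smooth_on_const[of 0]])
        fix y assume "y \<in> ?T"
        then obtain z where z: "z \<in> V - ?C" "y = \<xi> z" by blast
        then have "V.\<psi> y = z" by simp
        then show "0 = (?g \<circ> V.\<psi>) y" using g0[OF z(1)] by (simp only: comp_apply)
      qed
      moreover have "x \<notin> ?C"
      proof
        assume "x \<in> ?C"
        then obtain k where k: "k \<in> K" "x = \<psi> k" by blast
        then have "k \<in> S" "k \<in> \<phi> ` U" using K S by blast+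
        then show False using False k by simp
      qed
      ultimately show ?thesis using T x by blast
    qed
  qed
qed


section \<open>Tangent vectors in coordinates\<close>

lemma chart_function_derivative:
  assumes "g \<in> smooth_functions M" "p \<in> U"
  shows "((g \<circ> \<psi>) has_derivative frechet_derivative (g \<circ> \<psi>) (at (\<phi> p))) (at (\<phi> p))"
  by (rule smooth_on_has_derivative[of _ "\<phi> ` U"])
    (use assms chart in \<open>auto simp: smooth_functions_iff[OF manifold]\<close>)

lemma coord_vector_eqI:
  assumes "g \<in> smooth_functions M" "((g \<circ> \<psi>) has_derivative D) (at (\<phi> p))"
  shows "coord_vector M (U, \<phi>) p w g = D w"
  using assms frechet_derivative_at[OF assms(2)] by (simp add: coord_vector_def)

lemma coord_vector_tangent:
  assumes p: "p \<in> U"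
  shows "coord_vector M (U, \<phi>) p w \<in> tangent_space M p"
proof -
  let ?v = "coord_vector M (U, \<phi>) p w"
  let ?D = "\<lambda>g. frechet_derivative (g \<circ> \<psi>) (at (\<phi> p))"
  have v: "?v g = ?D g w" if "g \<in> smooth_functions M" for g using that by (simp add: coord_vector_def)
  have "?v (\<lambda>x. g x + h x) = ?v g + ?v h"
    if g: "g \<in> smooth_functions M" and h: "h \<in> smooth_functions M" for g h
  proof -
    have "((\<lambda>x. g x + h x) \<circ> \<psi> has_derivative (\<lambda>w. ?D g w + ?D h w)) (at (\<phi> p))"
      using has_derivative_add[OF chart_function_derivative[OF g p] chart_function_derivative[OF h p]]
      by (simp add: comp_def)
    from coord_vector_eqI[OF smooth_functions_add[OF manifold g h] this] show ?thesis by (simp add: v g h)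
  qed
  moreover have "?v (\<lambda>x. g x * h x) = g p * ?v h + h p * ?v g"
    if g: "g \<in> smooth_functions M" and h: "h \<in> smooth_functions M" for g h
  proof -
    have "((\<lambda>x. g x * h x) \<circ> \<psi> has_derivative (\<lambda>w. g p * ?D h w + ?D g w * h p)) (at (\<phi> p))"
      using has_derivative_mult[OF chart_function_derivative[OF g p] chart_function_derivative[OF h p]] p
      by (simp add: comp_def)
    from coord_vector_eqI[OF smooth_functions_mult[OF manifold g h] this] show ?thesis by (simp add: v g h)
  qed
  moreover have "?v (\<lambda>x. c * g x) = c * ?v g" if g: "g \<in> smooth_functions M" for g c
  proof -
    have "((\<lambda>x. c * g x) \<circ> \<psi> has_derivative (\<lambda>w. c * ?D g w)) (at (\<phi> p))"
      using has_derivative_mult_right[OF chart_function_derivative[OF g p]] by (simp add: comp_def)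
    from coord_vector_eqI[OF smooth_functions_mult[OF manifold smooth_functions_const[OF manifold] g] this]
    show ?thesis by (simp add: v g)
  qed
  moreover have "?v g = 0" if "g \<notin> smooth_functions M" for g using that by (simp add: coord_vector_def)
  ultimately show ?thesis by (simp add: tangent_space_def)
qed

end

lemma tangent_sum:
  assumes M: "smooth_manifold M" and v: "v \<in> tangent_space M p"
    and "\<And>i. i \<in> I \<Longrightarrow> g i \<in> smooth_functions M"
  shows "v (\<lambda>x. \<Sum>i\<in>I. g i x) = (\<Sum>i\<in>I. v (g i))"
proof -
  have v0: "v (\<lambda>x. 0) = 0"
  proof -
    have "v (\<lambda>x. 0 * 0) = 0 * v (\<lambda>x. 0)"
      using v smooth_functions_const[OF M, of 0] unfolding tangent_space_def mem_Collect_eq by meson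
    then show ?thesis by simp
  qed
  show ?thesis
    using assms(3)
  proof (induction I rule: infinite_finite_induct)
    case (insert i I)
    have "v (\<lambda>x. g i x + (\<Sum>j\<in>I. g j x)) = v (g i) + v (\<lambda>x. \<Sum>j\<in>I. g j x)"
      using v insert.prems smooth_functions_sum[OF M, of I g] by (simp add: tangent_space_def)
    then show ?case using insert by simp
  qed (use v0 in simp_all)
qed

context manifold_chart
begin

text \<open>With \<open>\<eta>\<close> a bump function at \<open>p\<close>, Hadamard's lemma writes \<open>\<eta>\<^sup>2 g\<close> as a combination of
  products of globally defined smooth functions, so that no locality of derivations is needed.\<close>

lemma tangent_space_coord:
  assumes p: "p \<in> U"
  shows "\<exists>w. (\<forall>v\<in>tangent_space M p. v = coord_vector M (U, \<phi>) p (w v)) \<and>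
    (\<forall>w'. w (coord_vector M (U, \<phi>) p w') = w')"
proof -
  obtain B :: "'e set" where "finite_basis B" using manifold_finite_basis[OF manifold] .
  then interpret finite_basis B .
  let ?c = "\<phi> p"
  obtain e where e: "e > 0" "ball ?c e \<subseteq> \<phi> ` U" using open_range p by (meson image_eqI open_contains_ball)
  \<comment> \<open>A ball, because Hadamard's lemma asks for a convex set.\<close>
  define S where "S = ball ?c e"
  have S: "open S" "convex S" "?c \<in> S" "S \<subseteq> \<phi> ` U" using e by (auto simp: S_def)
  obtain \<eta> :: "'e \<Rightarrow> real" and K where \<eta>: "smooth_on \<eta> UNIV" "\<eta> ?c = 1" and K: "compact K" "K \<subseteq> S"
    and \<eta>0: "\<And>x. x \<notin> K \<Longrightarrow> \<eta> x = 0"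
    by (rule smooth_bump[OF S(1,3)]) blast
  define E where "E h x = (if x \<in> U \<and> \<phi> x \<in> S then \<eta> (\<phi> x) * h (\<phi> x) else 0)" for h x
  have E: "E h \<in> smooth_functions M" if "smooth_on h S" for h
    unfolding E_def[abs_def]
    by (rule smooth_extension[OF S(1,4) K])
      (use \<eta>0 that smooth_on_subset[OF \<eta>(1)] in \<open>auto intro!: smooth_on_mult S\<close>)
  define X where "X b = E (\<lambda>y. coord b (y - ?c))" for b
  have sX: "smooth_on (\<lambda>y. coord b (y - ?c)) S" if "b \<in> B" for b
    by (intro smooth_on_coord that S smooth_on_diff smooth_on_ident smooth_on_const)
  have X: "X b \<in> smooth_functions M" if "b \<in> B" for b
    unfolding X_def using sX[OF that] by (rule E)
  \<comment> \<open>The components of \<open>v\<close> are its values on the centred coordinate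
    functions, cut off by \<open>\<eta>\<close> to be global.\<close>
  define w where "w v = (\<Sum>b\<in>B. v (X b) *\<^sub>R b)" for v :: "('p \<Rightarrow> real) \<Rightarrow> real"
  have "v g = coord_vector M (U, \<phi>) p (w v) g" if v: "v \<in> tangent_space M p" for v g
  proof (cases "g \<in> smooth_functions M")
    case False
    then show ?thesis using v by (simp add: tangent_space_def coord_vector_def)
  next
    case g: True
    have add: "v (\<lambda>x. g x + h x) = v g + v h" and mult: "v (\<lambda>x. g x * h x) = g p * v h + h p * v g"
      if "g \<in> smooth_functions M" "h \<in> smooth_functions M" for g h
      using v that by (simp_all add: tangent_space_def)
    have scale: "v (\<lambda>x. c * g x) = c * v g" if "g \<in> smooth_functions M" for g c
      using v that by (simp add: tangent_space_def)
    let ?D = "frechet_derivative (g \<circ> \<psi>) (at ?c)"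
    have sg: "smooth_on (g \<circ> \<psi>) S"
      using g chart S unfolding smooth_functions_iff[OF manifold] by (blast intro: smooth_on_subset)
    obtain G :: "'e \<Rightarrow> 'e \<Rightarrow> real" where G: "\<And>b. smooth_on (G b) S" "\<And>b. G b ?c = ?D b"
      "\<And>x. x \<in> S \<Longrightarrow> (g \<circ> \<psi>) x = (g \<circ> \<psi>) ?c + (\<Sum>b\<in>B. coord b (x - ?c) * G b x)"
      by (rule Hadamard[OF S(1-3) sg]) blast
    define \<eta>' where "\<eta>' = E (\<lambda>_. 1)"
    have \<eta>': "\<eta>' \<in> smooth_functions M" unfolding \<eta>'_def by (intro E smooth_on_const)
    have Q: "E (G b) \<in> smooth_functions M" for b by (intro E G)
    have at_p: "\<eta>' p = 1" "E (G b) p = ?D b" "X b p = 0" for b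
      using p S \<eta>(2) G(2) by (simp_all add: \<eta>'_def E_def X_def linear_0[OF coord_linear])
    \<comment> \<open>Of the two factors \<open>\<eta>'\<close>, one cuts off the coordinate
      function and the other \<open>G b\<close>; outside the chart region everything is
      zero.\<close>
    have eq: "\<eta>' x * \<eta>' x * g x = g p * (\<eta>' x * \<eta>' x) + (\<Sum>b\<in>B. X b x * E (G b) x)" for x
    proof (cases "x \<in> U \<and> \<phi> x \<in> S")
      case True
      then have "g x = g p + (\<Sum>b\<in>B. coord b (\<phi> x - ?c) * G b (\<phi> x))"
        using G(3)[of "\<phi> x"] p by simp
      then show ?thesis
        using True by (simp add: \<eta>'_def E_def X_def sum_distrib_left algebra_simps)
    qed (auto simp: \<eta>'_def E_def X_def)
    have \<eta>2: "(\<lambda>x. \<eta>' x * \<eta>' x) \<in> smooth_functions M"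
      by (rule smooth_functions_mult[OF manifold \<eta>' \<eta>'])
    have XQ: "(\<lambda>x. X b x * E (G b) x) \<in> smooth_functions M" if "b \<in> B" for b
      by (rule smooth_functions_mult[OF manifold X[OF that] Q])
    have "v (\<lambda>x. \<eta>' x * \<eta>' x * g x) = v (\<lambda>x. g p * (\<eta>' x * \<eta>' x) + (\<Sum>b\<in>B. X b x * E (G b) x))"
      unfolding eq ..
    also have "\<dots> = v (\<lambda>x. g p * (\<eta>' x * \<eta>' x)) + v (\<lambda>x. \<Sum>b\<in>B. X b x * E (G b) x)"
      by (rule add[OF smooth_functions_mult[OF manifold smooth_functions_const[OF manifold] \<eta>2]
            smooth_functions_sum[OF manifold XQ]])
    also have "v (\<lambda>x. \<Sum>b\<in>B. X b x * E (G b) x) = (\<Sum>b\<in>B. v (\<lambda>x. X b x * E (G b) x))"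
      by (rule tangent_sum[OF manifold v XQ])
    also have "\<dots> = (\<Sum>b\<in>B. ?D b * v (X b))"
      by (intro sum.cong refl) (simp add: mult[OF X Q] at_p)
    also have "v (\<lambda>x. g p * (\<eta>' x * \<eta>' x)) = g p * v (\<lambda>x. \<eta>' x * \<eta>' x)"
      by (rule scale[OF \<eta>2])
    \<comment> \<open>Expanding the left side by the product rule, with
      \<open>\<eta>' p = 1\<close>, gives \<open>v g\<close> plus the same multiple of
      \<open>g p\<close> as on the right, which cancels.\<close>
    finally have "v g = (\<Sum>b\<in>B. ?D b * v (X b))"
      using mult[OF \<eta>2 g] unfolding at_p by linarith
    moreover have "?D (w v) = (\<Sum>b\<in>B. v (X b) * ?D b)"
      using has_derivative_linear[OF chart_function_derivative[OF g p]]
      by (simp add: w_def linear_sum linear_scale)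
    ultimately show ?thesis using g by (simp add: coord_vector_def mult.commute)
  qed
  moreover have "w (coord_vector M (U, \<phi>) p w') = w'" for w'
  proof -
    have "coord_vector M (U, \<phi>) p w' (X b) = coord b w'" if b: "b \<in> B" for b
    proof (rule coord_vector_eqI[OF X[OF b]])
      have "((\<lambda>y. coord b (y - ?c)) has_derivative coord b) (at ?c)"
        using bounded_linear.has_derivative[OF coord_bounded_linear[OF b]
            has_derivative_diff[OF has_derivative_ident has_derivative_const]] by simp
      \<comment> \<open>At \<open>?c\<close> the coordinate vanishes and \<open>\<eta>\<close> is 1,
        so the cutoff does not alter the derivative.\<close>
      from has_derivative_mult[OF smooth_on_has_derivative[OF \<eta>(1) UNIV_I] this]
      have "((\<lambda>y. \<eta> y * coord b (y - ?c)) has_derivative coord b) (at ?c)"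
        by (simp add: \<eta>(2) linear_0[OF coord_linear])
      then show "((X b \<circ> \<psi>) has_derivative coord b) (at ?c)"
        by (rule has_derivative_transform_within_open[OF _ S(1,3)]) (use S in \<open>auto simp: X_def E_def\<close>)
    qed
    then show ?thesis by (simp add: w_def coord_sum)
  qed
  ultimately show ?thesis by blast
qed

lemma coord_vector_inject:
  "p \<in> U \<Longrightarrow> coord_vector M (U, \<phi>) p w = coord_vector M (U, \<phi>) p w' \<Longrightarrow> w = w'"
  using tangent_space_coord by metis

text \<open>Evaluates the description operator in \<open>bundle_chart\<close>.\<close>

lemma the_coord_vector:
  "p \<in> U \<Longrightarrow> (THE w'. coord_vector M (U, \<phi>) p w = coord_vector M (U, \<phi>) p w') = w"
  by (rule the_equality) (auto dest: coord_vector_inject)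

lemma coord_vector_the:
  assumes "p \<in> U" "v \<in> tangent_space M p"
  shows "coord_vector M (U, \<phi>) p (THE w. v = coord_vector M (U, \<phi>) p w) = v"
proof -
  obtain w where "v = coord_vector M (U, \<phi>) p w" using tangent_space_coord assms by blast
  then show ?thesis using the_coord_vector[OF assms(1)] by simp
qed

end


section \<open>Smooth maps in coordinates\<close>

locale map_in_charts =
  M: manifold_chart M A \<alpha> + N: manifold_chart N V \<beta>
  for M :: "('p, 'e::real_normed_vector) mfd" and A \<alpha>
    and N :: "('q, 'f::real_normed_vector) mfd" and V \<beta> +
  fixes F :: "'p \<Rightarrow> 'q"
  assumes F: "smooth_map M N F"
begin

definition rep_domain :: "'e set" where "rep_domain = \<alpha> ` (A \<inter> F -` V)"

definition rep :: "'e \<Rightarrow> 'f" where "rep = \<beta> \<circ> F \<circ> inv_into A \<alpha>"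

lemma open_rep_domain: "open rep_domain"
proof -
  have "continuous_map (mtop M) (mtop N) F" using F by (simp add: smooth_map_def)
  then have "openin (mtop M) {x \<in> pts M. F x \<in> V}"
    using N.open_domain by (rule openin_continuous_map_preimage)
  then have "openin (mtop M) (A \<inter> {x \<in> pts M. F x \<in> V})" by (rule openin_Int[OF M.open_domain])
  moreover have "A \<inter> {x \<in> pts M. F x \<in> V} = A \<inter> F -` V" using M.domain_subset by blast
  ultimately show ?thesis unfolding rep_domain_def by (intro M.open_image) auto
qed

lemma smooth_rep: "smooth_on rep rep_domain"
  using F M.chart N.chart unfolding smooth_map_def rep_def rep_domain_def by blast

lemma rep_domain_iff: "y \<in> rep_domain \<longleftrightarrow> y \<in> \<alpha> ` A \<and> F (inv_into A \<alpha> y) \<in> V"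
  unfolding rep_domain_def by (auto simp: image_iff intro!: bexI[of _ "inv_into A \<alpha> y"])

lemma rep_image: "rep ` rep_domain \<subseteq> \<beta> ` V"
  by (auto simp: rep_def rep_domain_iff)

lemma smooth_compose_rep:
  assumes "g \<in> smooth_functions N"
  shows "smooth_on (g \<circ> F \<circ> inv_into A \<alpha>) rep_domain"
proof -
  obtain B :: "'f set" where "finite_basis B" using manifold_finite_basis[OF N.manifold] .
  then interpret finite_basis B .
  have "smooth_on (g \<circ> inv_into V \<beta>) (\<beta> ` V)"
    using assms N.chart unfolding smooth_functions_iff[OF N.manifold] by blast
  from smooth_on_compose[OF open_rep_domain N.open_range rep_image smooth_rep this]
  show ?thesis
    by (rule smooth_on_cong[OF open_rep_domain]) (simp add: rep_def rep_domain_iff)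
qed

end

lemma map_in_chartsI:
  assumes "smooth_manifold M" "(A, \<alpha>) \<in> atlas M" "smooth_manifold N" "(V, \<beta>) \<in> atlas N" "smooth_map M N F"
  shows "map_in_charts M A \<alpha> N V \<beta> F"
  using assms by (simp add: map_in_charts_def map_in_charts_axioms_def manifold_chart_def)

text \<open>The image of a chart domain need not fit into one chart of \<open>N\<close>, so
  smoothness is checked near each point with a chart around its image.\<close>

lemma smooth_functions_compose:
  assumes M: "smooth_manifold M" and N: "smooth_manifold N" and F: "smooth_map M N F"
    and g: "g \<in> smooth_functions N"
  shows "g \<circ> F \<in> smooth_functions M"
  unfolding smooth_functions_iff[OF M]
proof clarify
  fix A \<alpha> assume a: "(A, \<alpha>) \<in> atlas M"
  interpret M: manifold_chart M A \<alpha> using M a by (rule manifold_chartI)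
  show "smooth_on ((g \<circ> F) \<circ> inv_into A \<alpha>) (\<alpha> ` A)"
  proof (rule smooth_on_locally)
    fix y assume y: "y \<in> \<alpha> ` A"
    then have "inv_into A \<alpha> y \<in> pts M" using M.domain_subset by auto
    then have "F (inv_into A \<alpha> y) \<in> pts N"
      using F unfolding smooth_map_def continuous_map_def by blast
    then obtain V \<beta> where V: "(V, \<beta>) \<in> atlas N" "F (inv_into A \<alpha> y) \<in> V"
      using chart_exists[OF N] by blast
    interpret map_in_charts M A \<alpha> N V \<beta> F using M a N V(1) F by (rule map_in_chartsI)
    show "\<exists>T. open T \<and> y \<in> T \<and> smooth_on ((g \<circ> F) \<circ> inv_into A \<alpha>) T"
      using open_rep_domain smooth_compose_rep[OF g] y V(2) rep_domain_iff by blast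
  qed
qed

context map_in_charts
begin

text \<open>This is the chain rule for \<open>g \<circ> F\<close> read as \<open>g\<close> in the
  chart of \<open>N\<close> after \<open>rep\<close>.\<close>

lemma pushforward_coord_vector:
  assumes y: "y \<in> rep_domain"
  shows "pushforward N F (coord_vector M (A, \<alpha>) (inv_into A \<alpha> y) u) =
    coord_vector N (V, \<beta>) (F (inv_into A \<alpha> y)) (frechet_derivative rep (at y) u)"
proof
  fix g
  let ?p = "inv_into A \<alpha> y"
  have p: "?p \<in> A" "F ?p \<in> V" "\<alpha> ?p = y" and rep_y: "rep y = \<beta> (F ?p)"
    using y by (auto simp: rep_domain_iff rep_def)
  show "pushforward N F (coord_vector M (A, \<alpha>) ?p u) g =
    coord_vector N (V, \<beta>) (F ?p) (frechet_derivative rep (at y) u) g"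
  proof (cases "g \<in> smooth_functions N")
    case True
    let ?D = "frechet_derivative (g \<circ> inv_into V \<beta>) (at (\<beta> (F ?p)))"
    have "((g \<circ> inv_into V \<beta>) has_derivative ?D) (at (rep y))"
      using N.chart_function_derivative[OF True p(2)] by (simp only: rep_y)
    then have "((\<lambda>y. (g \<circ> inv_into V \<beta>) (rep y)) has_derivative (\<lambda>u. ?D (frechet_derivative rep (at y) u))) (at y)"
      by (rule has_derivative_compose[OF smooth_on_has_derivative[OF smooth_rep y]])
    then have "((g \<circ> F) \<circ> inv_into A \<alpha> has_derivative (\<lambda>u. ?D (frechet_derivative rep (at y) u))) (at (\<alpha> ?p))"
      unfolding p(3) by (rule has_derivative_transform_within_open[OF _ open_rep_domain y])
        (simp add: rep_def rep_domain_iff)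
    from M.coord_vector_eqI[OF smooth_functions_compose[OF M.manifold N.manifold F True] this]
    show ?thesis using True by (simp add: pushforward_def coord_vector_def)
  qed (simp add: pushforward_def coord_vector_def)
qed

text \<open>\<open>smooth_submersion\<close> is phrased with derivations. Since every tangent vector
  has components, and these are unique, surjectivity passes to the Jacobian.\<close>

lemma rep_derivative_surj:
  assumes y: "y \<in> rep_domain" and "smooth_submersion M N F"
  shows "surj (frechet_derivative rep (at y))"
  unfolding surj_def
proof
  fix w
  let ?p = "inv_into A \<alpha> y"
  have p: "?p \<in> A" "F ?p \<in> V" using y by (auto simp: rep_domain_iff)
  then have "pushforward N F ` tangent_space M ?p = tangent_space N (F ?p)"
    using assms(2) M.domain_subset unfolding smooth_submersion_def by blast
  then obtain v where v: "v \<in> tangent_space M ?p" "pushforward N F v = coord_vector N (V, \<beta>) (F ?p) w"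
    using N.coord_vector_tangent[OF p(2)] by (metis imageE)
  obtain u where "v = coord_vector M (A, \<alpha>) ?p u" using M.tangent_space_coord p(1) v(1) by blast
  then have "coord_vector N (V, \<beta>) (F ?p) (frechet_derivative rep (at y) u) = coord_vector N (V, \<beta>) (F ?p) w"
    using v(2) pushforward_coord_vector[OF y] by simp
  then show "\<exists>u. w = frechet_derivative rep (at y) u" using N.coord_vector_inject p(2) by blast
qed

end


section \<open>Smooth time-dependent fields in coordinates\<close>

text \<open>The body repeats the description operator of \<open>bundle_chart\<close>, so this is the
  fibre part of the field's representation in charts.\<close>

definition field_components ::
  "('p, 'e::real_normed_vector) mfd \<Rightarrow> 'p set \<Rightarrow> ('p \<Rightarrow> 'e) \<Rightarrow> 'p td_field \<Rightarrow> 'e \<times> real \<Rightarrow> 'e" where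
  "field_components M U \<phi> f = (\<lambda>(y, t).
     THE w. f (inv_into U \<phi> y, t) = coord_vector M (U, \<phi>) (inv_into U \<phi> y) w)"

context manifold_chart
begin

lemma open_time_cylinder: "open S \<Longrightarrow> open (S \<times> (UNIV :: real set))"
  by (simp add: open_Times)

lemma inv_time_cylinder:
  "y \<in> \<phi> ` U \<Longrightarrow> inv_into (U \<times> UNIV) (map_prod \<phi> id) (y, t :: real) = (\<psi> y, t)"
proof -
  assume y: "y \<in> \<phi> ` U"
  have "inj_on (map_prod \<phi> (id :: real \<Rightarrow> real)) (U \<times> UNIV)"
    using inj by (auto simp: inj_on_def)
  from inv_into_f_f[OF this, of "(\<psi> y, t)"] show ?thesis using y by simp
qed

lemma prod_chart: "(U \<times> UNIV, map_prod \<phi> id) \<in> atlas (prod_mfd M real_line)"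
  using chart by (auto simp: prod_mfd_def vector_space_mfd_def)

lemma field_components_smooth:
  assumes f: "smooth_td_vector_field M f"
  shows "smooth_on (field_components M U \<phi> f) (\<phi> ` U \<times> UNIV)"
proof -
  let ?F = "\<lambda>(x, t). (x, f (x, t))"
  have tangent: "f (x, t) \<in> tangent_space M x" if "x \<in> U" for x t
    using f that domain_subset unfolding smooth_td_vector_field_def by fastforce
  have "smooth_map (prod_mfd M real_line) (tangent_bundle M) ?F"
    using f by (simp add: smooth_td_vector_field_def)
  moreover have "bundle_chart M (U, \<phi>) \<in> atlas (tangent_bundle M)"
    using chart by (simp add: tangent_bundle_def)
  ultimately have s: "smooth_on (snd (bundle_chart M (U, \<phi>)) \<circ> ?F \<circ> inv_into (U \<times> UNIV) (map_prod \<phi> id))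
      (map_prod \<phi> id ` ((U \<times> UNIV) \<inter> ?F -` fst (bundle_chart M (U, \<phi>))))"
    using prod_chart unfolding smooth_map_def by fastforce
  have dom: "map_prod \<phi> id ` ((U \<times> UNIV) \<inter> ?F -` fst (bundle_chart M (U, \<phi>))) = \<phi> ` U \<times> (UNIV :: real set)"
    using tangent by (force simp: bundle_chart_def)
  have open_T: "open (\<phi> ` U \<times> (UNIV :: real set))" by (rule open_time_cylinder[OF open_range])
  have "smooth_on (\<lambda>z. snd ((snd (bundle_chart M (U, \<phi>)) \<circ> ?F \<circ> inv_into (U \<times> UNIV) (map_prod \<phi> id)) z)) (\<phi> ` U \<times> UNIV)"
    using smooth_on_linear_compose[OF bounded_linear_snd open_T s[unfolded dom]] .
  then show ?thesis
    by (rule smooth_on_cong[OF open_T]) (auto simp: bundle_chart_def field_components_def inv_time_cylinder)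
qed

lemma field_components_eq:
  assumes "y \<in> \<phi> ` U" "f (\<psi> y, t) \<in> tangent_space M (\<psi> y)"
  shows "f (\<psi> y, t) = coord_vector M (U, \<phi>) (\<psi> y) (field_components M U \<phi> f (y, t))"
  using assms coord_vector_the[of "\<psi> y" "f (\<psi> y, t)"] by (simp add: field_components_def)

lemma field_components_eqI:
  assumes "y \<in> \<phi> ` U" "f (\<psi> y, t) = coord_vector M (U, \<phi>) (\<psi> y) w"
  shows "field_components M U \<phi> f (y, t) = w"
  using assms the_coord_vector[of "\<psi> y" w] by (simp add: field_components_def)

lemma open_time_preimage:
  assumes S: "open S"
  shows "openin (prod_topology (mtop M) euclidean) {(x, t :: real). x \<in> U \<and> (\<phi> x, t) \<in> S}"
  unfolding openin_prod_topology_alt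
proof (intro allI impI)
  fix x and t :: real assume "(x, t) \<in> {(x, t). x \<in> U \<and> (\<phi> x, t) \<in> S}"
  then have x: "x \<in> U" "(\<phi> x, t) \<in> S" by auto
  obtain P Q where PQ: "open P" "open Q" "\<phi> x \<in> P" "t \<in> Q" "P \<times> Q \<subseteq> S"
    using S x(2) by (metis open_prod_elim mem_Sigma_iff)
  show "\<exists>P Q. openin (mtop M) P \<and> openin euclidean Q \<and> x \<in> P \<and> t \<in> Q \<and>
      P \<times> Q \<subseteq> {(x, t). x \<in> U \<and> (\<phi> x, t) \<in> S}"
    using PQ x open_preimage[OF PQ(1)] by (intro exI[of _ "{x \<in> U. \<phi> x \<in> P}"] exI[of _ Q]) auto
qed

end

text \<open>\<open>smooth_map\<close> compares every chart of \<open>M\<close> with every bundle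
  chart. On an overlap, the representation arises from the components in the chart below the bundle
  chart by changing the base coordinates alone.\<close>

lemma smooth_td_vector_fieldI:
  fixes M :: "('p, 'e::real_normed_vector) mfd"
  assumes M: "smooth_manifold M"
    and f: "f \<in> (\<Pi>\<^sub>E (x, t) \<in> pts M \<times> UNIV. tangent_space M x)"
    and comp: "\<And>U \<phi>. (U, \<phi>) \<in> atlas M \<Longrightarrow> smooth_on (field_components M U \<phi> f) (\<phi> ` U \<times> UNIV)"
  shows "smooth_td_vector_field M f"
proof -
  let ?F = "\<lambda>(x, t). (x, f (x, t))"
  have tangent: "f (x, t) \<in> tangent_space M x" if "x \<in> pts M" for x t
    using f that by fastforce
  have chart_at: "\<exists>U \<phi>. (U, \<phi>) \<in> atlas M \<and> x \<in> U" if "x \<in> pts M" for x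
    using chart_exists[OF M that] by blast
  have cont: "continuous_map (prod_topology (mtop M) euclidean) (mtop (tangent_bundle M)) ?F"
    unfolding tangent_bundle_def mfd.simps continuous_on_generated_topo_iff
  proof (intro conjI allI impI)
    fix O' assume "O' \<in> {{z \<in> W. \<Phi> z \<in> S} | W \<Phi> S. (W, \<Phi>) \<in> bundle_chart M ` atlas M \<and> open S}"
    then obtain W \<Phi> S where W: "(W, \<Phi>) \<in> bundle_chart M ` atlas M" and S: "open S"
      and O': "O' = {z \<in> W. \<Phi> z \<in> S}"
      by blast
    from W obtain U \<phi> where c: "(U, \<phi>) \<in> atlas M" and W: "(W, \<Phi>) = bundle_chart M (U, \<phi>)"
      by auto
    interpret manifold_chart M U \<phi> using M c by (rule manifold_chartI)
    let ?T = "\<phi> ` U \<times> (UNIV :: real set)"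
    \<comment> \<open>In coordinates, the section followed by the bundle chart is \<open>?w\<close>;
      the preimage of the generator \<open>O'\<close> comes from an open set of coordinates and
      times.\<close>
    let ?w = "\<lambda>z. (fst z, field_components M U \<phi> f z)"
    have open_T: "open ?T" by (rule open_time_cylinder[OF open_range])
    have "continuous_on ?T ?w"
      by (intro continuous_on_Pair continuous_on_fst continuous_on_id smooth_on_continuous[OF comp[OF c]])
    then have "open (?w -` S \<inter> ?T)" using S continuous_on_open_vimage[OF open_T] by blast
    from open_time_preimage[OF this]
    have "openin (prod_topology (mtop M) euclidean) {(x, t). x \<in> U \<and> (\<phi> x, t) \<in> ?w -` S \<inter> ?T}" .
    moreover have "{(x, t). x \<in> U \<and> (\<phi> x, t) \<in> ?w -` S \<inter> ?T} =
        ?F -` O' \<inter> topspace (prod_topology (mtop M) euclidean)"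
      using tangent domain_subset W by (auto simp: O' bundle_chart_def field_components_def inj_on_eq_iff[OF inj])
    ultimately show "openin (prod_topology (mtop M) euclidean) (?F -` O' \<inter> topspace (prod_topology (mtop M) euclidean))"
      by argo
  next
    show "?F ` topspace (prod_topology (mtop M) euclidean) \<subseteq>
        \<Union> {{z \<in> W. \<Phi> z \<in> S} | W \<Phi> S. (W, \<Phi>) \<in> bundle_chart M ` atlas M \<and> open S}"
    proof clarify
      fix x and t :: real assume "(x, t) \<in> topspace (prod_topology (mtop M) euclidean)"
      then have x: "x \<in> pts M" by simp
      then obtain U \<phi> where c: "(U, \<phi>) \<in> atlas M" "x \<in> U" using chart_at by blast
      define W where "W = fst (bundle_chart M (U, \<phi>))"
      define \<Phi> where "\<Phi> = snd (bundle_chart M (U, \<phi>))"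
      have "(W, \<Phi>) \<in> bundle_chart M ` atlas M" using c by (force simp: W_def \<Phi>_def)
      moreover have "(x, f (x, t)) \<in> {z \<in> W. \<Phi> z \<in> UNIV}"
        using c tangent[OF x] by (simp add: W_def bundle_chart_def)
      ultimately show "(x, f (x, t)) \<in> \<Union> {{z \<in> W. \<Phi> z \<in> S} | W \<Phi> S. (W, \<Phi>) \<in> bundle_chart M ` atlas M \<and> open S}"
        using open_UNIV by blast
    qed
  qed
  have rep: "smooth_on (\<Phi> \<circ> ?F \<circ> inv_into U' \<phi>') (\<phi>' ` (U' \<inter> ?F -` W))"
    if pm: "(U', \<phi>') \<in> atlas (prod_mfd M real_line)" and tm: "(W, \<Phi>) \<in> atlas (tangent_bundle M)"
    for U' \<phi>' W \<Phi>
  proof -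
    from pm obtain U \<phi> where c: "(U, \<phi>) \<in> atlas M" and U': "U' = U \<times> UNIV" and \<phi>': "\<phi>' = map_prod \<phi> id"
      by (auto simp: prod_mfd_def vector_space_mfd_def)
    from tm obtain V \<xi> where d: "(V, \<xi>) \<in> atlas M"
      and W: "W = Sigma V (tangent_space M)"
      and \<Phi>: "\<Phi> = (\<lambda>(p, v). (\<xi> p, THE w. v = coord_vector M (V, \<xi>) p w))"
      by (force simp: tangent_bundle_def bundle_chart_def)
    interpret U: manifold_chart M U \<phi> using M c by (rule manifold_chartI)
    interpret V: manifold_chart M V \<xi> using M d by (rule manifold_chartI)
    obtain B :: "'e set" where B: "finite_basis B" using manifold_finite_basis[OF M] .
    obtain B' :: "('e \<times> real) set" where B': "finite_basis B'" using finite_basis_Pair_real[OF B] .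
    let ?S = "\<phi> ` (U \<inter> V)"
    have open_S: "open ?S" by (intro U.open_image openin_Int U.open_domain V.open_domain) auto
    have open_T: "open (?S \<times> (UNIV :: real set))" by (rule U.open_time_cylinder[OF open_S])
    have dom: "\<phi>' ` (U' \<inter> ?F -` W) = ?S \<times> UNIV"
      using tangent U.domain_subset by (force simp: U' \<phi>' W)
    let ?\<tau> = "\<lambda>z :: 'e \<times> real. (\<xi> \<circ> U.\<psi>) (fst z)"
    have \<tau>: "smooth_on ?\<tau> (?S \<times> UNIV)"
      by (rule finite_basis.smooth_on_compose[OF B open_T open_S _
            smooth_on_bounded_linear[OF bounded_linear_fst] U.transition_smooth[OF d]]) auto
    have \<tau>_id: "smooth_on (\<lambda>z. (?\<tau> z, snd z)) (?S \<times> UNIV)"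
      by (intro smooth_on_Pair open_T \<tau> smooth_on_bounded_linear bounded_linear_snd)
    have "smooth_on (\<lambda>z. field_components M V \<xi> f (?\<tau> z, snd z)) (?S \<times> UNIV)"
      by (rule finite_basis.smooth_on_compose[OF B' open_T V.open_time_cylinder[OF V.open_range] _ \<tau>_id comp[OF d]]) auto
    then have "smooth_on (\<lambda>z. (?\<tau> z, field_components M V \<xi> f (?\<tau> z, snd z))) (?S \<times> UNIV)"
      by (rule smooth_on_Pair[OF open_T \<tau>])
    then show ?thesis
      unfolding dom
    proof (rule smooth_on_cong[OF open_T])
      fix z assume "z \<in> ?S \<times> (UNIV :: real set)"
      then obtain x t where z: "z = (\<phi> x, t)" "x \<in> U" "x \<in> V" by auto
      then show "(?\<tau> z, field_components M V \<xi> f (?\<tau> z, snd z)) = (\<Phi> \<circ> ?F \<circ> inv_into U' \<phi>') z"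
        by (simp add: \<Phi> U' \<phi>' U.inv_time_cylinder field_components_def)
    qed
  qed
  have "mtop (prod_mfd M real_line) = prod_topology (mtop M) euclidean"
    by (simp add: prod_mfd_def vector_space_mfd_def)
  then have "smooth_map (prod_mfd M real_line) (tangent_bundle M) ?F"
    unfolding smooth_map_def using cont by (auto intro!: rep)
  then show ?thesis using f by (simp add: smooth_td_vector_field_def)
qed


section \<open>Pushing a field forward along a submersion\<close>

lemma components_of_related_field:
  fixes M :: "('p, 'e::real_normed_vector) mfd" and N :: "('q, 'f::real_normed_vector) mfd"
  assumes M: "smooth_manifold M" and N: "smooth_manifold N"
    and q: "smooth_submersion M N q" "q ` pts M = pts N"
    and f: "smooth_td_vector_field M f" and rel: "related_fields M N q f g"
    and d: "(V, \<beta>) \<in> atlas N"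
  shows "smooth_on (field_components N V \<beta> g) (\<beta> ` V \<times> UNIV)"
proof (rule smooth_on_locally)
  fix z assume "z \<in> \<beta> ` V \<times> (UNIV :: real set)"
  then obtain x t where x: "x \<in> V" "z = (\<beta> x, t)" by auto
  interpret N: manifold_chart N V \<beta> using N d by (rule manifold_chartI)
  have "x \<in> q ` pts M" using x N.domain_subset q(2) by blast
  \<comment> \<open>Any point of the fibre will do, since the Jacobian of \<open>q\<close> is
    surjective at each of them.\<close>
  then obtain p where p: "p \<in> pts M" "q p = x" by blast
  obtain A \<alpha> where a: "(A, \<alpha>) \<in> atlas M" "p \<in> A" using chart_exists[OF M p(1)] .
  have smooth_q: "smooth_map M N q" using q(1) by (simp add: smooth_submersion_def)
  interpret map_in_charts M A \<alpha> N V \<beta> q using M a(1) N d smooth_q by (rule map_in_chartsI)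
  obtain BE :: "'e set" where BE: "finite_basis BE" using manifold_finite_basis[OF M] .
  obtain BF :: "'f set" where BF: "finite_basis BF" using manifold_finite_basis[OF N] .
  obtain BE' :: "('e \<times> real) set" where BE': "finite_basis BE'" using finite_basis_Pair_real[OF BE] .
  have p_dom: "\<alpha> p \<in> rep_domain" and rep_p: "rep (\<alpha> p) = \<beta> x"
    using a p x by (auto simp: rep_domain_iff rep_def)
  obtain V' s where V': "open V'" "rep (\<alpha> p) \<in> V'" "s ` V' \<subseteq> rep_domain" and s: "smooth_on s V'"
    and section_s: "\<And>y. y \<in> V' \<Longrightarrow> rep (s y) = y"
    by (rule local_right_inverse[OF BE BF open_rep_domain p_dom smooth_rep rep_derivative_surj[OF p_dom q(1)]]) blast
  let ?T = "V' \<times> (UNIV :: real set)"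
  let ?u = "\<lambda>z. field_components M A \<alpha> f (s (fst z), snd z)"
  have open_T: "open ?T" by (rule N.open_time_cylinder[OF V'(1)])
  have s_fst: "smooth_on (\<lambda>z. s (fst z)) ?T"
    by (rule finite_basis.smooth_on_compose[OF BF open_T V'(1) _
          smooth_on_bounded_linear[OF bounded_linear_fst] s]) auto
  have s_id: "smooth_on (\<lambda>z. (s (fst z), snd z)) ?T"
    by (intro smooth_on_Pair open_T s_fst smooth_on_bounded_linear bounded_linear_snd)
  have u: "smooth_on ?u ?T"
    by (rule finite_basis.smooth_on_compose[OF BE' open_T M.open_time_cylinder[OF M.open_range] _ s_id
          M.field_components_smooth[OF f]])
      (use V'(3) rep_domain_iff in fastforce)
  have "smooth_on (\<lambda>z. frechet_derivative rep (at (s (fst z))) (?u z)) ?T"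
    by (rule finite_basis.smooth_on_joint_derivative[OF BE open_T open_rep_domain _ s_fst smooth_rep u])
      (use V'(3) in auto)
  then have "smooth_on (field_components N V \<beta> g) ?T"
  proof (rule smooth_on_cong[OF open_T])
    fix z' assume "z' \<in> ?T"
    then obtain y t where y: "y \<in> V'" "z' = (y, t)" by auto
    let ?p = "inv_into A \<alpha> (s y)"
    have sy: "s y \<in> rep_domain" using V'(3) y by blast
    then have "?p \<in> A" "q ?p \<in> V" by (auto simp: rep_domain_iff)
    moreover have "\<beta> (q ?p) = y" using section_s[OF y(1)] by (simp add: rep_def)
    \<comment> \<open>Since \<open>rep (s y) = y\<close>, the point \<open>?p\<close> lies over the
      point with coordinates \<open>y\<close>; in particular \<open>y\<close> is in the range of the
      chart.\<close>
    ultimately have qp: "q ?p = inv_into V \<beta> y" and y_range: "y \<in> \<beta> ` V"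
      using N.left_inverse by (metis, metis imageI)
    have tangent: "f (?p, t) \<in> tangent_space M ?p"
      using f \<open>?p \<in> A\<close> M.domain_subset unfolding smooth_td_vector_field_def by fastforce
    have "g (q ?p, t) = pushforward N q (f (?p, t))"
      using rel \<open>?p \<in> A\<close> M.domain_subset unfolding related_fields_def by (metis subsetD)
    also have "f (?p, t) = coord_vector M (A, \<alpha>) ?p (?u z')"
      using M.field_components_eq[of "s y" f t] tangent sy y(2) by (simp add: rep_domain_iff)
    also have "pushforward N q \<dots> = coord_vector N (V, \<beta>) (q ?p) (frechet_derivative rep (at (s y)) (?u z'))"
      by (rule pushforward_coord_vector[OF sy])
    finally show "frechet_derivative rep (at (s (fst z'))) (?u z') = field_components N V \<beta> g z'"
      using N.field_components_eqI[OF y_range] y(2) by (simp add: qp)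
  qed
  then show "\<exists>T. open T \<and> z \<in> T \<and> smooth_on (field_components N V \<beta> g) T"
    using open_T V'(2) rep_p x(2) by (intro exI[of _ ?T]) simp
qed

text \<open>Relatedness prescribes the values at all points \<open>q x\<close>, which exhaust
  \<open>N\<close>; off \<open>N\<close> both fields are \<open>undefined\<close>, being members of
  the same extensional product.\<close>

lemma related_field_unique:
  fixes M :: "('p, 'e::real_normed_vector) mfd" and N :: "('q, 'f::real_normed_vector) mfd"
  assumes q: "q ` pts M = pts N"
    and f: "smooth_td_vector_field N f" "related_fields M N q h f"
    and g: "smooth_td_vector_field N g" "related_fields M N q h g"
  shows "f = g"
proof (rule PiE_ext)
  show "f \<in> (\<Pi>\<^sub>E z \<in> pts N \<times> UNIV. tangent_space N (fst z))"
    and "g \<in> (\<Pi>\<^sub>E z \<in> pts N \<times> UNIV. tangent_space N (fst z))"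
    using f(1) g(1) unfolding smooth_td_vector_field_def case_prod_beta by simp_all
  fix z :: "'q \<times> real" assume "z \<in> pts N \<times> UNIV"
  then obtain x t where x: "x \<in> pts M" "z = (q x, t)" using q by force
  then show "f z = g z" using f(2) g(2) unfolding related_fields_def by metis
qed

text \<open>The group enters the result only through the fibres of \<open>q\<close>. In this form
  the condition says that \<open>f\<close> differentiates pulled-back functions equally along each
  fibre, which is exactly independence of the representative.\<close>

theorem related_field_exists:
  fixes M :: "('p, 'e::real_normed_vector) mfd" and N :: "('q, 'f::real_normed_vector) mfd"
  assumes M: "smooth_manifold M" and N: "smooth_manifold N"
    and q: "smooth_submersion M N q" "q ` pts M = pts N"
    and f: "smooth_td_vector_field M f"
    and fibres: "\<And>x y t g. \<lbrakk>x \<in> pts M; y \<in> pts M; q x = q y; g \<in> smooth_functions N\<rbrakk>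
        \<Longrightarrow> f (x, t) (g \<circ> q) = f (y, t) (g \<circ> q)"
  shows "\<exists>!g. smooth_td_vector_field N g \<and> related_fields M N q f g"
proof -
  \<comment> \<open>An arbitrary choice of representatives; smoothness of \<open>g\<close> is later
    drawn from relatedness, not from \<open>pt\<close>.\<close>
  define pt where "pt x = (SOME p. p \<in> pts M \<and> q p = x)" for x
  define g where "g = (\<lambda>(x, t). if x \<in> pts N then pushforward N q (f (pt x, t)) else undefined)"
  have "pt x \<in> pts M \<and> q (pt x) = x" if "x \<in> pts N" for x
    unfolding pt_def
    by (rule someI_ex[of "\<lambda>p. p \<in> pts M \<and> q p = x"]) (use that q(2)[symmetric] in auto)
  then have pt: "pt x \<in> pts M" "q (pt x) = x" if "x \<in> pts N" for x using that by simp_all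
  have tangent: "f (x, t) \<in> tangent_space M x" if "x \<in> pts M" for x t
    using f that unfolding smooth_td_vector_field_def by fastforce
  have rel: "related_fields M N q f g"
    unfolding related_fields_def
  proof (intro ballI allI ext)
    fix x t h assume x: "x \<in> pts M"
    then have qx: "q x \<in> pts N" using q(2) by blast
    show "pushforward N q (f (x, t)) h = g (q x, t) h"
      using fibres[OF x pt(1)[OF qx] pt(2)[OF qx, symmetric]] qx by (simp add: g_def pushforward_def)
  qed
  have "g (x, t) \<in> tangent_space N x" if x: "x \<in> pts N" for x t
  proof -
    have "pushforward N q ` tangent_space M (pt x) = tangent_space N x"
      using q(1) pt[OF x] unfolding smooth_submersion_def by metis
    then show ?thesis using tangent[OF pt(1)[OF x], of t] x by (auto simp: g_def)
  qed
  then have "g \<in> (\<Pi>\<^sub>E (x, t) \<in> pts N \<times> UNIV. tangent_space N x)"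
    by (auto simp: PiE_iff extensional_def g_def)
  then have "smooth_td_vector_field N g"
    by (rule smooth_td_vector_fieldI[OF N]) (rule components_of_related_field[OF M N q f rel])
  then show ?thesis using rel related_field_unique[OF q(2)] by blast
qed

section \<open>Orbits of a Lie group action as the fibres\<close>

theorem corollary3:
  fixes G :: "('g, 'z) monoid_scheme"
    and \<Gamma> :: "('g, 'k::real_normed_vector) mfd"
    and Xt :: "('p, 'e::real_normed_vector) mfd"
    and act :: "'g \<Rightarrow> 'p \<Rightarrow> 'p"
    and X :: "('p set, 'f::real_normed_vector) mfd"
    and ft :: "'p td_field"
  assumes "lie_group G \<Gamma>"
    and "smooth_manifold Xt"
    and "smooth_action G \<Gamma> Xt act"
    and "free_action G (pts Xt) act"
    and "proper_action (mtop \<Gamma>) (mtop Xt) act"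
    and "quotient_manifold G Xt act X"
    and "smooth_td_vector_field Xt ft"
    and "\<And>s. \<lbrakk>s \<in> smooth_functions Xt;
            \<forall>x\<in>pts Xt. \<forall>\<gamma>\<in>carrier G. s x = s (act \<gamma> x)\<rbrakk>
          \<Longrightarrow> \<forall>x\<in>pts Xt. \<forall>t. \<forall>\<gamma>\<in>carrier G.
                lie_derivative ft s (x, t) = lie_derivative ft s (act \<gamma> x, t)"
  shows "\<exists>!f. smooth_td_vector_field X f \<and> related_fields Xt X (orbit G act) ft f"
proof (rule related_field_exists)
  interpret group_action G "pts Xt" act using assms(3) by (simp add: smooth_action_def)
  have X: "smooth_manifold X" "pts X = orbits G (pts Xt) act" "smooth_submersion Xt X (orbit G act)"
    using assms(6) by (auto simp: quotient_manifold_def)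
  show "smooth_manifold Xt" "smooth_manifold X" "smooth_submersion Xt X (orbit G act)"
    "smooth_td_vector_field Xt ft"
    by fact+
  show "orbit G act ` pts Xt = pts X" unfolding X(2) orbits_def by blast
  fix x y t g
  assume x: "x \<in> pts Xt" and y: "y \<in> pts Xt" and xy: "orbit G act x = orbit G act y"
    and g: "g \<in> smooth_functions X"
  have "smooth_map Xt X (orbit G act)" using X(3) by (simp add: smooth_submersion_def)
  then have s: "g \<circ> orbit G act \<in> smooth_functions Xt"
    using smooth_functions_compose assms(2) X(1) g by blast
  \<comment> \<open>Both orbits contain \<open>act \<gamma> z\<close>, and distinct orbits are
    disjoint.\<close>
  have "orbit G act (act \<gamma> z) = orbit G act z" if z: "z \<in> pts Xt" and \<gamma>: "\<gamma> \<in> carrier G" for z \<gamma>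
  proof -
    have az: "act \<gamma> z \<in> pts Xt" using element_image[OF \<gamma> z refl] .
    have "act \<gamma> z \<in> orbit G act z" using \<gamma> by (auto simp: orbit_def)
    moreover have "act \<gamma> z \<in> orbit G act (act \<gamma> z)" using orbit_refl[OF az] .
    moreover have "orbit G act z \<in> orbits G (pts Xt) act" "orbit G act (act \<gamma> z) \<in> orbits G (pts Xt) act"
      using z az by (auto simp: orbits_def)
    ultimately show ?thesis using disjoint_union by blast
  qed
  then have "\<forall>z\<in>pts Xt. \<forall>\<gamma>\<in>carrier G. (g \<circ> orbit G act) z = (g \<circ> orbit G act) (act \<gamma> z)" by simp
  from assms(8)[OF s this] have
    "\<forall>z\<in>pts Xt. \<forall>t. \<forall>\<gamma>\<in>carrier G. ft (z, t) (g \<circ> orbit G act) = ft (act \<gamma> z, t) (g \<circ> orbit G act)"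
    by (simp only: lie_derivative_def prod.case)
  \<comment> \<open>Points of one fibre differ by a group element, so invariance under the action is
    constancy along fibres.\<close>
  moreover have "y \<in> orbit G act x" using orbit_refl[OF y] xy by simp
  then obtain \<gamma> where "\<gamma> \<in> carrier G" "y = act \<gamma> x" by (auto simp: orbit_def)
  ultimately show "ft (x, t) (g \<circ> orbit G act) = ft (y, t) (g \<circ> orbit G act)" using x by blast
qed

end
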